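(* Let $G$ be a Lie group with Lie algebra $\mathfrak g$. The Poisson reduction by $G$ of the symplectic manifold ${}^{1}T^*TG=(G\circledS\mathfrak g_1)\circledS(\mathfrak g_2^*\times\mathfrak g_3^* )\ni(g,\xi,\mu,\nu)$ is $\mathfrak g_1\circledS(\mathfrak g_2^*\times\mathfrak g_3^* )\ni(\xi,\mu,\nu)$ with the following Poisson bracket: the functions on ${}^{1}T^*TG$ that do not depend on $g$ are closed under the Poisson bracket of ${}^{1}T^*TG$, and for two such functions $H,K$ the bracket is $$\{H,K\}(\xi,\mu,\nu)=\Big\langle\frac{\delta K}{\delta\xi},\frac{\delta H}{\delta\nu}\Big\rangle-\Big\langle\frac{\delta H}{\delta\xi},\frac{\delta K}{\delta\nu}\Big\rangle+\Big\langle\mu,\Big[\frac{\delta H}{\delta\mu},\frac{\delta K}{\delta\mu}\Big]\Big\rangle$$ $$\qquad+\Big\langle ad^*_\xi\frac{\delta K}{\delta\xi},\frac{\delta H}{\delta\mu}\Big\rangle-\Big\langle ad^*_\xi\frac{\delta H}{\delta\xi},\frac{\delta K}{\delta\mu}\Big\rangle+\Big\langle\nu,\Big[\frac{\delta H}{\delta\mu},\frac{\delta K}{\delta\nu}\Big]-\Big[\frac{\delta K}{\delta\mu},\frac{\delta H}{\delta\nu}\Big]\Big\rangle.$$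
   Context: Conventions. $G$ is a (finite-dimensional) Lie group with identity $e$, $\mathfrak g=T_eG$, $\mathfrak g^*$ its dual, $\mathfrak g^{**}=\mathfrak g$. $R_g$ is right translation. $Ad_g$ is the tangent map at $e$ of $h\mapsto g^{-1}hg$; the Lie bracket is $[\xi,\eta]=ad_\xi\eta=\frac{d}{dt}|_{t=0}Ad_{\exp(t\xi)}\eta$ (the bracket of right invariant vector fields). $ad^*_\xi$ is defined by $\langle ad^*_\xi\mu,\eta\rangle=\langle\mu,[\xi,\eta]\rangle$. Partial derivatives: $\delta H/\delta\xi\in\mathfrak g^*$, $\delta H/\delta\mu,\delta H/\delta\nu\in\mathfrak g$. As a manifold ${}^{1}T^*TG=G\times\mathfrak g\times\mathfrak g^*\times\mathfrak g^*$ (subscripts on copies of $\mathfrak g,\mathfrak g^*$ are only labels). For $(\eta,\zeta,\lambda_1,\lambda_2)\in\mathfrak g\times\mathfrak g\times\mathfrak g^*\times\mathfrak g^*$ let $$X_{(\eta,\zeta,\lambda_1,\lambda_2)}(g,\xi,\mu,\nu)=(T_eR_g\eta,\ \zeta+[\xi,\eta],\ \lambda_1+ad^*_\eta\mu+ad^*_\zeta\nu,\ \lambda_2+ad^*_\eta\nu).$$ The symplectic form is determined by $$\Omega(X_{(\eta,\zeta,\lambda_1,\lambda_2)},X_{(\bar\eta,\bar\zeta,\bar\lambda_1,\bar\lambda_2)})=\langle\lambda_1,\bar\eta\rangle+\langle\lambda_2,\bar\zeta\rangle-\langle\bar\lambda_1,\eta\rangle-\langle\bar\lambda_2,\zeta\rangle+\langle\mu,[\eta,\bar\eta]\rangle+\langle\nu,[\eta,\bar\zeta]-[\bar\eta,\zeta]\rangle.$$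 Hamiltonian vector fields are given by $i_{X_H}\Omega=-dH$ and the Poisson bracket by $\{H,K\}=\Omega(X_H,X_K)=-\langle dH,X_K\rangle$. Functions independent of $g$ (called "right invariant under $G$") are identified with functions on the quotient $\mathfrak g_1\circledS(\mathfrak g_2^*\times\mathfrak g_3^* )$. *)

theory Defs
  imports "HOL-Analysis.Analysis" "HOL-Algebra.Group"
begin

section \<open>Smooth maps between finite-dimensional normed spaces\<close>

text \<open>
  \<open>Ck_on k S f\<close> is used for open \<open>S\<close> and finite-dimensional domains only. There, having all
  directional derivatives of class \<open>C\<^sup>k\<close> is the same as the derivative being of class \<open>C\<^sup>k\<close>.
\<close>

primrec Ck_on :: "nat \<Rightarrow> 'a::real_normed_vector set \<Rightarrow> ('a \<Rightarrow> 'b::real_normed_vector) \<Rightarrow> bool" where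
  "Ck_on 0 S f \<longleftrightarrow> continuous_on S f"
| "Ck_on (Suc k) S f \<longleftrightarrow>
     (\<forall>x\<in>S. f differentiable (at x)) \<and>
     (\<forall>v. Ck_on k S (\<lambda>x. frechet_derivative f (at x) v))"

definition smooth_on :: "'a::real_normed_vector set \<Rightarrow> ('a \<Rightarrow> 'b::real_normed_vector) \<Rightarrow> bool" where
  "smooth_on S f \<longleftrightarrow> (\<forall>k. Ck_on k S f)"


section \<open>Manifolds, smooth maps and tangent maps\<close>

text \<open>
  The points of a manifold form a whole type \<open>'p\<close>, and the charts take values in a
  finite-dimensional normed space \<open>'v\<close>, which is allowed to be zero-dimensional (the class
  \<^class>\<open>euclidean_space\<close> would exclude discrete groups, and the product type of a space with its
  dual is not an instance of it). A chart is a domain together with a coordinate map.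

  A manifold carries a preferred chart \<open>chart_at M p\<close> around each point \<open>p\<close>, and the tangent space
  at \<open>p\<close> is a copy of \<open>'v\<close>: a tangent vector is represented by its coordinates in the preferred
  chart at its base point. The tangent map is the derivative read in the preferred charts.
\<close>

type_synonym ('p, 'v) chart = "'p set \<times> ('p \<Rightarrow> 'v)"

abbreviation cdom :: "('p, 'v) chart \<Rightarrow> 'p set" where "cdom c \<equiv> fst c"
abbreviation cmap :: "('p, 'v) chart \<Rightarrow> 'p \<Rightarrow> 'v" where "cmap c \<equiv> snd c"

definition cinv :: "('p, 'v) chart \<Rightarrow> 'v \<Rightarrow> 'p" where
  "cinv c = inv_into (cdom c) (cmap c)"

record ('p, 'v) manifold =
  atlas :: "('p, 'v) chart set"
  chart_at :: "'p \<Rightarrow> ('p, 'v) chart"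

definition smooth_map ::
  "('p::topological_space, 'v::real_normed_vector) manifold \<Rightarrow>
   ('q::topological_space, 'w::real_normed_vector) manifold \<Rightarrow> ('p \<Rightarrow> 'q) \<Rightarrow> bool" where
  "smooth_map M N f \<longleftrightarrow> continuous_on UNIV f \<and>
     (\<forall>c\<in>atlas M. \<forall>d\<in>atlas N.
        smooth_on (cmap c ` (cdom c \<inter> f -` cdom d)) (cmap d \<circ> f \<circ> cinv c))"

definition tangent_map ::
  "('p, 'v::real_normed_vector) manifold \<Rightarrow> ('q, 'w::real_normed_vector) manifold \<Rightarrow>
   ('p \<Rightarrow> 'q) \<Rightarrow> 'p \<Rightarrow> 'v \<Rightarrow> 'w" where
  "tangent_map M N f p =
     frechet_derivative (cmap (chart_at N (f p)) \<circ> f \<circ> cinv (chart_at M p))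
       (at (cmap (chart_at M p) p))"

definition vector_manifold :: "('v, 'v) manifold" where
  "vector_manifold = \<lparr>atlas = {(UNIV, id)}, chart_at = (\<lambda>_. (UNIV, id))\<rparr>"

definition prod_chart :: "('p, 'v) chart \<Rightarrow> ('q, 'w) chart \<Rightarrow> ('p \<times> 'q, 'v \<times> 'w) chart" where
  "prod_chart c d = (cdom c \<times> cdom d, map_prod (cmap c) (cmap d))"

definition prod_manifold ::
  "('p, 'v) manifold \<Rightarrow> ('q, 'w) manifold \<Rightarrow> ('p \<times> 'q, 'v \<times> 'w) manifold" where
  "prod_manifold M N =
     \<lparr>atlas = {prod_chart c d |c d. c \<in> atlas M \<and> d \<in> atlas N},
      chart_at = (\<lambda>(p, q). prod_chart (chart_at M p) (chart_at N q))\<rparr>"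

text \<open>
  Finite-dimensional normed spaces are complete, so the class \<^class>\<open>banach\<close> is no restriction.
  Second countability is not required.
\<close>

locale smooth_manifold =
  fixes M :: "('p::t2_space, 'v::banach) manifold"
  assumes finite_dim: "\<exists>B::'v set. finite B \<and> span B = UNIV"
    and open_chart_domain: "c \<in> atlas M \<Longrightarrow> open (cdom c)"
    and open_chart_image: "c \<in> atlas M \<Longrightarrow> open (cmap c ` cdom c)"
    and chart_homeomorphism:
      "c \<in> atlas M \<Longrightarrow> homeomorphism (cdom c) (cmap c ` cdom c) (cmap c) (cinv c)"
    and charts_compatible:
      "c \<in> atlas M \<Longrightarrow> d \<in> atlas M \<Longrightarrow>
         smooth_on (cmap c ` (cdom c \<inter> cdom d)) (cmap d \<circ> cinv c)"
    and chart_at_in_atlas: "chart_at M p \<in> atlas M"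
    and chart_at_covers: "p \<in> cdom (chart_at M p)"


section \<open>Lie groups\<close>

locale lie_group = group G + smooth_manifold M
  for G :: "'g::t2_space monoid" (structure) and M :: "('g, 'v::banach) manifold" +
  assumes carrier_UNIV: "carrier G = UNIV"
    and smooth_mult: "smooth_map (prod_manifold M M) M (\<lambda>(x, y). x \<otimes> y)"
    and smooth_inverse: "smooth_map M M (\<lambda>x. inv x)"

text \<open>
  The Lie algebra \<open>\<gg>\<close>, the tangent space at the identity, is the type \<open>'v\<close>, and its
  dual is the type \<open>'v \<Rightarrow>\<^sub>L real\<close>: all linear functionals are bounded in finite dimension.
\<close>

definition one_parameter_subgroup ::
  "'g::t2_space monoid \<Rightarrow> ('g, 'v::banach) manifold \<Rightarrow> (real \<Rightarrow> 'g) \<Rightarrow> bool" where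
  "one_parameter_subgroup G M \<gamma> \<longleftrightarrow>
     smooth_map vector_manifold M \<gamma> \<and> (\<forall>s t. \<gamma> (s + t) = \<gamma> s \<otimes>\<^bsub>G\<^esub> \<gamma> t)"

definition lie_exp :: "'g::t2_space monoid \<Rightarrow> ('g, 'v::banach) manifold \<Rightarrow> 'v \<Rightarrow> 'g" where
  "lie_exp G M \<xi> =
     (THE \<gamma>. one_parameter_subgroup G M \<gamma> \<and> tangent_map vector_manifold M \<gamma> 0 1 = \<xi>) 1"

definition Ad :: "'g::t2_space monoid \<Rightarrow> ('g, 'v::banach) manifold \<Rightarrow> 'g \<Rightarrow> 'v \<Rightarrow> 'v" where
  "Ad G M g = tangent_map M M (\<lambda>h. inv\<^bsub>G\<^esub> g \<otimes>\<^bsub>G\<^esub> h \<otimes>\<^bsub>G\<^esub> g) \<one>\<^bsub>G\<^esub>"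

text \<open>With this convention for \<open>Ad\<close>, \<open>lie_bracket\<close> is the bracket of right invariant vector fields.\<close>

definition lie_bracket ::
  "'g::t2_space monoid \<Rightarrow> ('g, 'v::banach) manifold \<Rightarrow> 'v \<Rightarrow> 'v \<Rightarrow> 'v" where
  "lie_bracket G M \<xi> \<eta> = vector_derivative (\<lambda>t::real. Ad G M (lie_exp G M (t *\<^sub>R \<xi>)) \<eta>) (at 0)"

definition coad ::
  "'g::t2_space monoid \<Rightarrow> ('g, 'v::banach) manifold \<Rightarrow> 'v \<Rightarrow> ('v \<Rightarrow>\<^sub>L real) \<Rightarrow> ('v \<Rightarrow>\<^sub>L real)" where
  "coad G M \<xi> \<mu> = Blinfun (\<lambda>\<eta>. blinfun_apply \<mu> (lie_bracket G M \<xi> \<eta>))"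

definition right_translation_tangent ::
  "'g::t2_space monoid \<Rightarrow> ('g, 'v::banach) manifold \<Rightarrow> 'g \<Rightarrow> 'v \<Rightarrow> 'v" where
  "right_translation_tangent G M g = tangent_map M M (\<lambda>h. h \<otimes>\<^bsub>G\<^esub> g) \<one>\<^bsub>G\<^esub>"


section \<open>The symplectic manifold and its Poisson bracket\<close>

text \<open>
  The manifold is \<open>G \<times> (\<gg> \<times> \<gg>\<^sup>* \<times> \<gg>\<^sup>*)\<close>, the second factor being the
  quotient by \<open>G\<close>. By the choice of preferred charts on a product, a tangent vector at
  \<open>(g, \<xi>, \<mu>, \<nu>)\<close> is a quadruple whose first component is tangent to \<open>G\<close> at \<open>g\<close>.
\<close>

type_synonym 'v reduced_space = "'v \<times> ('v \<Rightarrow>\<^sub>L real) \<times> ('v \<Rightarrow>\<^sub>L real)"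
type_synonym ('g, 'v) phase_space = "'g \<times> 'v reduced_space"
type_synonym 'v phase_vector = "'v \<times> 'v reduced_space"

definition phase_manifold ::
  "('g, 'v::banach) manifold \<Rightarrow> (('g, 'v) phase_space, 'v phase_vector) manifold" where
  "phase_manifold M = prod_manifold M vector_manifold"

text \<open>The vector field \<open>X\<close>, indexed by \<open>(\<eta>, \<zeta>, \<alpha>, \<beta>)\<close>.\<close>

fun frame ::
  "'g::t2_space monoid \<Rightarrow> ('g, 'v::banach) manifold \<Rightarrow> 'v phase_vector \<Rightarrow>
   ('g, 'v) phase_space \<Rightarrow> 'v phase_vector" where
  "frame G M (\<eta>, \<zeta>, \<alpha>, \<beta>) (g, \<xi>, \<mu>, \<nu>) =
     (right_translation_tangent G M g \<eta>,
      \<zeta> + lie_bracket G M \<xi> \<eta>,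
      \<alpha> + coad G M \<eta> \<mu> + coad G M \<zeta> \<nu>,
      \<beta> + coad G M \<eta> \<nu>)"

fun omega_on_frame ::
  "'g::t2_space monoid \<Rightarrow> ('g, 'v::banach) manifold \<Rightarrow> ('g, 'v) phase_space \<Rightarrow>
   'v phase_vector \<Rightarrow> 'v phase_vector \<Rightarrow> real" where
  "omega_on_frame G M (g, \<xi>, \<mu>, \<nu>) (\<eta>, \<zeta>, \<alpha>, \<beta>) (\<eta>', \<zeta>', \<alpha>', \<beta>') =
     blinfun_apply \<alpha> \<eta>' + blinfun_apply \<beta> \<zeta>' - blinfun_apply \<alpha>' \<eta> - blinfun_apply \<beta>' \<zeta>
     + blinfun_apply \<mu> (lie_bracket G M \<eta> \<eta>')
     + blinfun_apply \<nu> (lie_bracket G M \<eta> \<zeta>' - lie_bracket G M \<eta>' \<zeta>)"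

definition symplectic_form ::
  "'g::t2_space monoid \<Rightarrow> ('g, 'v::banach) manifold \<Rightarrow> ('g, 'v) phase_space \<Rightarrow>
   'v phase_vector \<Rightarrow> 'v phase_vector \<Rightarrow> real" where
  "symplectic_form G M p =
     (THE \<Omega>. \<forall>a b. \<Omega> (frame G M a p) (frame G M b p) = omega_on_frame G M p a b)"

definition differential ::
  "('g, 'v::banach) manifold \<Rightarrow> (('g, 'v) phase_space \<Rightarrow> real) \<Rightarrow> ('g, 'v) phase_space \<Rightarrow>
   'v phase_vector \<Rightarrow> real" where
  "differential M H p = tangent_map (phase_manifold M) vector_manifold H p"

definition hamiltonian_field ::
  "'g::t2_space monoid \<Rightarrow> ('g, 'v::banach) manifold \<Rightarrow> (('g, 'v) phase_space \<Rightarrow> real) \<Rightarrow>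
   ('g, 'v) phase_space \<Rightarrow> 'v phase_vector" where
  "hamiltonian_field G M H p =
     (THE V. \<forall>W. symplectic_form G M p V W = - differential M H p W)"

definition poisson_bracket ::
  "'g::t2_space monoid \<Rightarrow> ('g, 'v::banach) manifold \<Rightarrow> (('g, 'v) phase_space \<Rightarrow> real) \<Rightarrow>
   (('g, 'v) phase_space \<Rightarrow> real) \<Rightarrow> ('g, 'v) phase_space \<Rightarrow> real" where
  "poisson_bracket G M H K p =
     symplectic_form G M p (hamiltonian_field G M H p) (hamiltonian_field G M K p)"


section \<open>Functions on the quotient and their partial derivatives\<close>

definition invariant_functions ::
  "('g::t2_space, 'v::banach) manifold \<Rightarrow> (('g, 'v) phase_space \<Rightarrow> real) set" where
  "invariant_functions M =
     {H. smooth_map (phase_manifold M) vector_manifold H \<and> (\<forall>g g' x. H (g, x) = H (g', x))}"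

definition delta_xi :: "('v::banach reduced_space \<Rightarrow> real) \<Rightarrow> 'v reduced_space \<Rightarrow> ('v \<Rightarrow>\<^sub>L real)" where
  "delta_xi H = (\<lambda>(\<xi>, \<mu>, \<nu>). Blinfun (frechet_derivative (\<lambda>x. H (x, \<mu>, \<nu>)) (at \<xi>)))"

text \<open>The identification of the bidual of \<open>\<gg>\<close> with \<open>\<gg>\<close> is made explicit here.\<close>

definition delta_mu :: "('v::banach reduced_space \<Rightarrow> real) \<Rightarrow> 'v reduced_space \<Rightarrow> 'v" where
  "delta_mu H = (\<lambda>(\<xi>, \<mu>, \<nu>).
     THE v. \<forall>\<alpha>. frechet_derivative (\<lambda>m. H (\<xi>, m, \<nu>)) (at \<mu>) \<alpha> = blinfun_apply \<alpha> v)"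

definition delta_nu :: "('v::banach reduced_space \<Rightarrow> real) \<Rightarrow> 'v reduced_space \<Rightarrow> 'v" where
  "delta_nu H = (\<lambda>(\<xi>, \<mu>, \<nu>).
     THE v. \<forall>\<alpha>. frechet_derivative (\<lambda>n. H (\<xi>, \<mu>, n)) (at \<nu>) \<alpha> = blinfun_apply \<alpha> v)"

end

theory Submission
  imports Defs
begin

text \<open>
  On a right invariant function \<open>h \<circ> snd\<close> the frame \<open>X\<close> turns \<open>i\<^bsub>X_H\<^esub> \<Omega> = - dH\<close> into linear equations
  whose solution is \<open>(\<delta>H/\<delta>\<mu>, \<delta>H/\<delta>\<nu>, - ad\<^sup>*\<^bsub>\<xi>\<^esub> \<delta>H/\<delta>\<xi>, - \<delta>H/\<delta>\<xi>)\<close>, and substituting two such solutions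
  into \<open>\<Omega>\<close> gives the bracket. This needs only that the Lie bracket is bilinear and antisymmetric.

  Both properties rest on the existence and uniqueness of one-parameter subgroups. Two of them with
  the same velocity have a quotient of velocity zero, which is therefore constant; existence follows
  from the Picard iteration near the identity and the group law. In a chart,
  \<open>[\<xi>, \<eta>]\<close> is then a mixed second derivative of \<open>(x, h) \<mapsto> x\<^sup>-\<^sup>1 h x\<close>, hence bilinear, and
  \<open>[\<xi>, \<xi>] = 0\<close> because \<open>exp (t \<xi>)\<close> commutes with \<open>exp (s \<xi>)\<close>.
\<close>

section \<open>Coordinates and calculus in finite-dimensional normed spaces\<close>

text \<open>The objects of the theorem are defined by descriptions and choices:
  \<open>lie_exp\<close>, \<open>symplectic_form\<close>, \<open>hamiltonian_field\<close>,
  \<open>delta_mu\<close> and \<open>delta_nu\<close> by \<open>THE\<close>,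
  \<open>lie_bracket\<close> by \<open>vector_derivative\<close>, dual elements by
  \<open>Blinfun\<close>. None can be computed with before existence and uniqueness are known, so
  even linearity of the bracket waits for one-parameter subgroups in every direction. Two further
  obstacles shape the work. The model space is only a Banach space with a finite spanning set, so
  coefficient functionals are constructed and shown bounded by hand; they serve the chain rule for
  \<open>Ck_on\<close>, the bidual and the smoothness of the bracket. Tangent vectors are read in a
  preferred chart that changes with the base point, so derivatives are handled as a relation between
  arbitrary charts. The quantity that drives the group theory is the left logarithmic derivative
  \<open>left_velocity\<close>: it is constant along a homomorphism from the reals, and a quotient
  of two curves sharing it has left logarithmic derivative zero. Uniqueness and the local group law
  both follow from this.\<close>

text \<open>Boundedness of the coefficient functionals is part of the notion: it is what turns
  finite expansions into continuous and differentiable expressions.\<close>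

definition coordinates :: "'a::real_normed_vector set \<Rightarrow> ('a \<Rightarrow> 'a \<Rightarrow> real) \<Rightarrow> bool" where
  "coordinates B \<beta> \<longleftrightarrow> finite B \<and> (\<forall>b\<in>B. bounded_linear (\<beta> b)) \<and>
     (\<forall>x. x = (\<Sum>b\<in>B. \<beta> b x *\<^sub>R b))"

lemma coordinatesD:
  assumes "coordinates B \<beta>"
  shows "finite B" "b \<in> B \<Longrightarrow> bounded_linear (\<beta> b)" "(\<Sum>b\<in>B. \<beta> b x *\<^sub>R b) = x"
  using assms unfolding coordinates_def by auto

lemma linear_coordinates_expand:
  fixes L :: "'a::real_normed_vector \<Rightarrow> 'b::real_normed_vector"
  assumes "coordinates (B :: 'a set) \<beta>" "linear L"
  shows "L x = (\<Sum>b\<in>B. \<beta> b x *\<^sub>R L b)"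
proof -
  have "L x = L (\<Sum>b\<in>B. \<beta> b x *\<^sub>R b)" using coordinatesD(3)[OF assms(1)] by simp
  also have "\<dots> = (\<Sum>b\<in>B. \<beta> b x *\<^sub>R L b)"
    by (simp add: linear_sum[OF assms(2)] linear_scale[OF assms(2)])
  finally show ?thesis .
qed

lemma coordinates_linear_imp_bounded_linear:
  fixes L :: "'a::real_normed_vector \<Rightarrow> 'b::real_normed_vector"
  assumes "coordinates (B :: 'a set) \<beta>" "linear L"
  shows "bounded_linear L"
proof -
  have "L = (\<lambda>x. \<Sum>b\<in>B. \<beta> b x *\<^sub>R L b)"
    using linear_coordinates_expand[OF assms] by blast
  moreover have "bounded_linear (\<lambda>x. \<Sum>b\<in>B. \<beta> b x *\<^sub>R L b)"
    by (intro bounded_linear_sum bounded_linear_scaleR_left[THEN bounded_linear_compose]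
        coordinatesD[OF assms(1)])
  ultimately show ?thesis by simp
qed

text \<open>Induction on the set. A further vector a has positive distance from
  \<open>span B\<close>: if vectors of the span converged to a, the bound for B would make their
  coefficients Cauchy, and the limits would express a in \<open>span B\<close>.\<close>

lemma coefficients_bounded_of_independent:
  fixes B :: "'a::real_normed_vector set"
  assumes "finite B" "independent B"
  shows "\<exists>C\<ge>0. \<forall>c. \<forall>b\<in>B. \<bar>c b\<bar> \<le> C * norm (\<Sum>b\<in>B. c b *\<^sub>R b)"
  using assms
proof (induction B rule: finite_induct)
  case empty
  then show ?case by (auto intro: exI[of _ 0])
next
  case (insert a B)
  then have indB: "independent B" and aB: "a \<notin> span B"
    by (auto simp: independent_insert)
  obtain C where C0: "C \<ge> 0" and C: "\<And>c b. b \<in> B \<Longrightarrow> \<bar>c b\<bar> \<le> C * norm (\<Sum>b\<in>B. c b *\<^sub>R b)"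
    using insert.IH[OF indB] by blast
  have "\<exists>d>0. \<forall>x\<in>span B. d \<le> norm (a - x)"
  proof (rule ccontr)
    assume "\<not> ?thesis"
    then have "\<exists>x\<in>span B. norm (a - x) < 1 / real (Suc n)" for n
      by (metis not_le of_nat_0_less_iff zero_less_Suc zero_less_divide_1_iff)
    then obtain x where xs: "\<And>n. x n \<in> span B" and xn: "\<And>n. norm (a - x n) < 1 / real (Suc n)"
      by metis
    have "(\<lambda>n. a - x n) \<longlonglongrightarrow> 0"
      by (rule Lim_null_comparison[OF _ lim_1_over_n[THEN LIMSEQ_Suc]])
         (intro always_eventually allI less_imp_le[OF xn])
    from tendsto_diff[OF tendsto_const this, of a] have xa: "x \<longlonglongrightarrow> a" by simp
    have "\<exists>c. x n = (\<Sum>b\<in>B. c b *\<^sub>R b)" for n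
      using xs[of n] unfolding span_finite[OF insert.hyps(1)] by auto
    then obtain c where c: "\<And>n. x n = (\<Sum>b\<in>B. c n b *\<^sub>R b)" by metis
    have "\<exists>l. (\<lambda>n. c n b) \<longlonglongrightarrow> l" if "b \<in> B" for b
    proof -
      have "Cauchy x" using xa LIMSEQ_imp_Cauchy by blast
      have "Cauchy (\<lambda>n. c n b)"
      proof (rule metric_CauchyI)
        fix e :: real assume "e > 0"
        then have "e / (C + 1) > 0" using C0 by simp
        then obtain N where N: "\<And>m n. m \<ge> N \<Longrightarrow> n \<ge> N \<Longrightarrow> dist (x m) (x n) < e / (C+1)"
          using metric_CauchyD[OF \<open>Cauchy x\<close>] by meson
        have "dist (c m b) (c n b) < e" if mn: "m \<ge> N" "n \<ge> N" for m n
        proof -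
          have "\<bar>c m b - c n b\<bar> \<le> C * norm (\<Sum>b\<in>B. (c m b - c n b) *\<^sub>R b)"
            using C[OF \<open>b \<in> B\<close>, of "\<lambda>b. c m b - c n b"] by simp
          also have "\<dots> = C * dist (x m) (x n)"
            by (simp add: c dist_norm scaleR_diff_left sum_subtractf)
          also have "\<dots> \<le> (C + 1) * dist (x m) (x n)" by (intro mult_right_mono) auto
          also have "\<dots> < (C + 1) * (e / (C+1))"
            using N[OF mn] C0 by (intro mult_strict_left_mono) auto
          finally show ?thesis using C0 by (simp add: dist_real_def)
        qed
        then show "\<exists>M. \<forall>m\<ge>M. \<forall>n\<ge>M. dist (c m b) (c n b) < e" by blast
      qed
      then show ?thesis using convergent_eq_Cauchy by blast
    qed
    then obtain l where l: "\<And>b. b \<in> B \<Longrightarrow> (\<lambda>n. c n b) \<longlonglongrightarrow> l b" by metis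
    have "x \<longlonglongrightarrow> (\<Sum>b\<in>B. l b *\<^sub>R b)"
      unfolding c[abs_def] by (intro tendsto_intros l)
    with xa have "a = (\<Sum>b\<in>B. l b *\<^sub>R b)" using LIMSEQ_unique by blast
    also have "\<dots> \<in> span B" by (intro span_sum span_scale span_base)
    finally show False using aB by simp
  qed
  then obtain d where d0: "d > 0" and d: "\<And>x. x \<in> span B \<Longrightarrow> d \<le> norm (a - x)" by blast
  \<comment> \<open>The summand 1/d bounds the coefficient of the new vector. The other one bounds
    the old coefficients, because their part of the sum has norm at most (1 + norm a / d) times that
    of the whole.\<close>
  define K where "K = 1/d + C * (1 + norm a / d)"
  have "\<bar>c b\<bar> \<le> K * norm (\<Sum>b\<in>insert a B. c b *\<^sub>R b)" if "b \<in> insert a B" for c b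
  proof -
    let ?S = "\<Sum>b\<in>B. c b *\<^sub>R b"
    let ?N = "norm (\<Sum>b\<in>insert a B. c b *\<^sub>R b)"
    have sp: "?S \<in> span B" by (intro span_sum span_scale span_base)
    have N: "?N = norm (c a *\<^sub>R a + ?S)" using insert.hyps by simp
    have ca: "\<bar>c a\<bar> \<le> ?N / d"
    proof (cases "c a = 0")
      case False
      \<comment> \<open>Dividing the whole sum by \<open>c a\<close> leaves a minus an element of
        \<open>span B\<close>.\<close>
      have "d \<le> norm (a - (- (1 / c a)) *\<^sub>R ?S)" by (intro d span_scale sp)
      then have "\<bar>c a\<bar> * d \<le> \<bar>c a\<bar> * norm (a - (- (1 / c a)) *\<^sub>R ?S)" by (intro mult_left_mono) auto
      also have "\<dots> = norm (c a *\<^sub>R (a - (- (1 / c a)) *\<^sub>R ?S))" by simp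
      also have "c a *\<^sub>R (a - (- (1 / c a)) *\<^sub>R ?S) = c a *\<^sub>R a + ?S"
        using False by (simp add: scaleR_add_right)
      finally show ?thesis using d0 N by (simp add: field_simps)
    qed (use d0 in auto)
    have aux: "0 \<le> C * (1 + norm a / d) * ?N" "0 \<le> 1/d * ?N" using C0 d0 by auto
    show ?thesis
    proof (cases "b = a")
      case True
      then show ?thesis using ca aux by (simp add: K_def algebra_simps)
    next
      case False
      then have "b \<in> B" using that by simp
      have "?S = (c a *\<^sub>R a + ?S) - c a *\<^sub>R a" by simp
      then have "norm ?S \<le> ?N + \<bar>c a\<bar> * norm a" using N norm_triangle_ineq4
        by (metis norm_scaleR)
      also have "\<dots> \<le> ?N + ?N / d * norm a" using ca by (intro add_left_mono mult_right_mono) auto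
      finally have "norm ?S \<le> (1 + norm a / d) * ?N" by (simp add: algebra_simps)
      then have "C * norm ?S \<le> C * ((1 + norm a / d) * ?N)" using C0 by (intro mult_left_mono)
      then show ?thesis using C[OF \<open>b \<in> B\<close>, of c] aux unfolding K_def
        by (simp add: algebra_simps)
    qed
  qed
  moreover have "K \<ge> 0" using C0 d0 by (auto simp: K_def)
  ultimately show ?case by blast
qed

lemma finite_span_imp_coordinates:
  fixes B :: "'a::real_normed_vector set"
  assumes "finite B" "span B = UNIV"
  shows "\<exists>B (\<beta> :: 'a \<Rightarrow> 'a \<Rightarrow> real). coordinates B \<beta>"
proof -
  obtain B' where B': "B' \<subseteq> B" "independent B'" "span B' = span B"
    using maximal_independent_subset[of B] span_mono span_span by (metis subset_antisym)
  have fin: "finite B'" using B'(1) assms(1) finite_subset by blast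
  have sp: "x \<in> span B'" for x using B' assms by simp
  obtain C where C: "\<And>c b. b \<in> B' \<Longrightarrow> \<bar>c b\<bar> \<le> C * norm (\<Sum>b\<in>B'. c b *\<^sub>R b)"
    using coefficients_bounded_of_independent[OF fin B'(2)] by blast
  let ?\<beta> = "\<lambda>b x. representation B' x b"
  have ex: "(\<Sum>b\<in>B'. ?\<beta> b x *\<^sub>R b) = x" for x
    by (rule real_vector.sum_representation_eq[OF B'(2) sp fin]) simp
  have "bounded_linear (?\<beta> b)" if "b \<in> B'" for b
  proof (rule bounded_linear_intro[where K = C])
    show "?\<beta> b (x + y) = ?\<beta> b x + ?\<beta> b y" for x y
      by (simp add: real_vector.representation_add[OF B'(2) sp sp])
    show "?\<beta> b (r *\<^sub>R x) = r *\<^sub>R ?\<beta> b x" for r x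
      by (simp add: real_vector.representation_scale[OF B'(2) sp])
    show "norm (?\<beta> b x) \<le> norm x * C" for x
      using C[OF that, of "\<lambda>b. ?\<beta> b x"] by (simp add: ex mult.commute)
  qed
  then have "coordinates B' ?\<beta>" unfolding coordinates_def using fin ex by auto
  then show ?thesis by blast
qed

lemma coordinates_prod:
  assumes "coordinates (B :: 'a::real_normed_vector set) \<beta>" "coordinates (C :: 'b::real_normed_vector set) \<gamma>"
  shows "\<exists>(B :: ('a \<times> 'b) set) \<beta>. coordinates B \<beta>"
proof (rule finite_span_imp_coordinates)
  let ?B = "(\<lambda>b. (b, 0)) ` B \<union> (\<lambda>c. (0, c)) ` C"
  show "finite ?B" using coordinatesD(1)[OF assms(1)] coordinatesD(1)[OF assms(2)] by auto
  have "(x, y) \<in> span ?B" for x y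
  proof -
    have "(x, 0) = (\<Sum>b\<in>B. \<beta> b x *\<^sub>R (b, 0::'b))"
      using coordinatesD(3)[OF assms(1), of x] by (simp add: prod_eq_iff fst_sum snd_sum)
    moreover have "(0, y) = (\<Sum>b\<in>C. \<gamma> b y *\<^sub>R (0::'a, b))"
      using coordinatesD(3)[OF assms(2), of y] by (simp add: prod_eq_iff fst_sum snd_sum)
    ultimately have "(x, y) = (\<Sum>b\<in>B. \<beta> b x *\<^sub>R (b, 0::'b)) + (\<Sum>b\<in>C. \<gamma> b y *\<^sub>R (0::'a, b))"
      by (metis add.left_neutral add.right_neutral add_Pair)
    then show ?thesis
      by (simp only:) (intro span_add span_sum span_scale span_base; auto)
  qed
  then show "span ?B = UNIV" by auto
qed

text \<open>The coefficient functionals play the part of a dual basis: apply \<alpha> to the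
  expansion of its argument.\<close>

lemma coordinates_dual:
  assumes "coordinates (B :: 'a::real_normed_vector set) \<beta>"
  shows "(\<alpha> :: 'a \<Rightarrow>\<^sub>L real) = (\<Sum>b\<in>B. blinfun_apply \<alpha> b *\<^sub>R Blinfun (\<beta> b))"
proof (rule blinfun_eqI)
  fix x
  have "blinfun_apply \<alpha> x = (\<Sum>b\<in>B. \<beta> b x *\<^sub>R blinfun_apply \<alpha> b)"
    by (rule linear_coordinates_expand[OF assms]) (simp add: bounded_linear.linear blinfun.bounded_linear_right)
  also have "\<dots> = blinfun_apply (\<Sum>b\<in>B. blinfun_apply \<alpha> b *\<^sub>R Blinfun (\<beta> b)) x"
    using coordinatesD(2)[OF assms]
    by (simp add: blinfun.sum_left blinfun.scaleR_left bounded_linear_Blinfun_apply mult.commute)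
  finally show "blinfun_apply \<alpha> x = \<dots>" .
qed

section \<open>Calculus of maps of class \<open>Ck_on\<close> and of smooth maps\<close>

lemma Ck_on_SucD:
  assumes "Ck_on (Suc k) S f" "x \<in> S"
  shows "(f has_derivative frechet_derivative f (at x)) (at x)"
  using assms by (simp add: frechet_derivative_works)

text \<open>On an open set, equality of the functions passes to the full derivatives at each point,
  so the induction can continue with the directional derivatives.\<close>

lemma Ck_on_cong:
  assumes "open S" "\<And>x. x \<in> S \<Longrightarrow> f x = g x" "Ck_on k S f"
  shows "Ck_on k S g"
  using assms(2-)
proof (induction k arbitrary: f g)
  case 0
  then show ?case by (auto cong: continuous_on_cong)
next
  case (Suc k)
  have d: "(g has_derivative frechet_derivative f (at x)) (at x)" if "x \<in> S" for x
    by (rule has_derivative_transform_within_open[OF Ck_on_SucD[OF Suc.prems(2) that] assms(1) that])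
       (use Suc.prems in auto)
  have "frechet_derivative f (at x) = frechet_derivative g (at x)" if "x \<in> S" for x
    using frechet_derivative_at[OF d[OF that]] by simp
  then have "Ck_on k S (\<lambda>x. frechet_derivative g (at x) v)" for v
    using Suc.prems(2) by (rule_tac Suc.IH[of "\<lambda>x. frechet_derivative f (at x) v"]) auto
  then show ?case using d by (auto simp: differentiable_def)
qed

text \<open>Uniqueness of derivatives allows an explicit derivative in place of the chosen
  \<open>frechet_derivative\<close>. The closure properties below rest on this rule.\<close>

lemma Ck_on_SucI:
  assumes "open S" "\<And>x. x \<in> S \<Longrightarrow> (f has_derivative f' x) (at x)" "\<And>v. Ck_on k S (\<lambda>x. f' x v)"
  shows "Ck_on (Suc k) S f"
proof -
  have "Ck_on k S (\<lambda>x. frechet_derivative f (at x) v)" for v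
    by (rule Ck_on_cong[OF assms(1) _ assms(3)[of v]])
       (use frechet_derivative_at[OF assms(2)] in auto)
  then show ?thesis using assms(2) by (auto simp: differentiable_def)
qed

lemma Ck_on_Suc_imp: "Ck_on (Suc k) S f \<Longrightarrow> Ck_on k S f"
proof (induction k arbitrary: f)
  case 0
  then show ?case
    by (auto intro!: continuous_at_imp_continuous_on differentiable_imp_continuous_within)
next
  case (Suc k)
  then show ?case by (metis Ck_on.simps(2))
qed

lemma Ck_on_const: "open S \<Longrightarrow> Ck_on k S (\<lambda>x. c)"
proof (induction k arbitrary: c)
  case (Suc k)
  show ?case by (rule Ck_on_SucI[where f' = "\<lambda>x v. 0"]) (auto intro: Suc)
qed auto

lemma Ck_on_bounded_linear_compose:
  assumes "open S" "bounded_linear L" "Ck_on k S f"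
  shows "Ck_on k S (\<lambda>x. L (f x))"
  using assms(3)
proof (induction k arbitrary: f)
  case 0
  then show ?case using bounded_linear.continuous_on[OF assms(2)] by simp
next
  case (Suc k)
  show ?case
    by (rule Ck_on_SucI[OF assms(1) bounded_linear.has_derivative[OF assms(2) Ck_on_SucD[OF Suc.prems]]])
      (use Suc in auto)
qed

lemma Ck_on_bounded_linear:
  assumes "open S" "bounded_linear L"
  shows "Ck_on k S L"
proof (cases k)
  case 0
  then show ?thesis using assms by (simp add: linear_continuous_on)
next
  case (Suc n)
  then show ?thesis
    using Ck_on_SucI[OF assms(1) bounded_linear.has_derivative[OF assms(2) has_derivative_ident]]
      Ck_on_const[OF assms(1)] by fast
qed

lemma Ck_on_add:
  assumes "open S" "Ck_on k S f" "Ck_on k S g"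
  shows "Ck_on k S (\<lambda>x. f x + g x)"
  using assms(2,3)
proof (induction k arbitrary: f g)
  case (Suc k)
  show ?case
    by (rule Ck_on_SucI[OF assms(1) has_derivative_add[OF Ck_on_SucD[OF Suc.prems(1)] Ck_on_SucD[OF Suc.prems(2)]]])
      (use Suc in auto)
qed (simp add: continuous_on_add)

lemma Ck_on_sum:
  assumes "open S" "\<And>i. i \<in> I \<Longrightarrow> Ck_on k S (f i)"
  shows "Ck_on k S (\<lambda>x. \<Sum>i\<in>I. f i x)"
  using assms(2)
  by (induction I rule: infinite_finite_induct)
     (auto intro: Ck_on_const[OF assms(1)] Ck_on_add[OF assms(1)])

lemma Ck_on_bilinear:
  assumes "open S" "bounded_bilinear b" "Ck_on k S f" "Ck_on k S g"
  shows "Ck_on k S (\<lambda>x. b (f x) (g x))"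
  using assms(3,4)
proof (induction k arbitrary: f g)
  case 0
  then show ?case using bounded_bilinear.continuous_on[OF assms(2)] by auto
next
  case (Suc k)
  have "Ck_on k S (\<lambda>x. frechet_derivative f (at x) v)" "Ck_on k S (\<lambda>x. frechet_derivative g (at x) v)" for v
    using Suc.prems by auto
  moreover have "Ck_on k S f" "Ck_on k S g" using Suc.prems Ck_on_Suc_imp by blast+
  ultimately show ?case
    by (intro Ck_on_SucI[OF assms(1) bounded_bilinear.FDERIV[OF assms(2) Ck_on_SucD[OF Suc.prems(1)] Ck_on_SucD[OF Suc.prems(2)]]]
        Ck_on_add[OF assms(1)] Suc.IH)
qed

lemma Ck_on_Pair:
  assumes "open S" "Ck_on k S f" "Ck_on k S g"
  shows "Ck_on k S (\<lambda>x. (f x, g x))"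
proof -
  have "Ck_on k S (\<lambda>x. (f x, 0) + (0, g x))"
    by (intro Ck_on_add assms Ck_on_bounded_linear_compose[where L = "\<lambda>x. (x, 0)"]
        Ck_on_bounded_linear_compose[where L = "\<lambda>x. (0, x)"] bounded_linear_Pair
        bounded_linear_ident bounded_linear_zero)
  then show ?thesis by simp
qed

text \<open>In the chain rule the direction \<open>?f x v\<close> fed into the derivative of g
  varies with x, whereas \<open>Ck_on\<close> speaks of fixed directions. Expanding it in
  coordinates of the middle space leaves directional derivatives of g along fixed b, to which the
  induction hypothesis applies, times smooth coefficients.\<close>

lemma Ck_on_compose:
  fixes f :: "'a::real_normed_vector \<Rightarrow> 'b::real_normed_vector"
    and g :: "'b \<Rightarrow> 'c::real_normed_vector"
  assumes co: "coordinates (B :: 'b set) \<beta>" and "open S" "open T" "f ` S \<subseteq> T" "Ck_on k T g" "Ck_on k S f"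
  shows "Ck_on k S (\<lambda>x. g (f x))"
  using assms(5,6)
proof (induction k arbitrary: g)
  case 0
  then show ?case using continuous_on_compose2 assms(4) by auto
next
  case (Suc k)
  let ?g = "\<lambda>y. frechet_derivative g (at y)" and ?f = "\<lambda>x. frechet_derivative f (at x)"
  have d: "((\<lambda>x. g (f x)) has_derivative (\<lambda>v. ?g (f x) (?f x v))) (at x)" if "x \<in> S" for x
    using has_derivative_compose[OF Ck_on_SucD[OF Suc.prems(2) that] Ck_on_SucD[OF Suc.prems(1)]] 
      that assms(4) by auto
  have f: "Ck_on k S f" "Ck_on k S (\<lambda>x. ?f x v)" for v
    using Suc.prems(2) Ck_on_Suc_imp[OF Suc.prems(2)] by auto
  have g: "Ck_on k S (\<lambda>x. ?g (f x) b)" for b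
    by (rule Suc.IH[OF _ f(1)]) (use Suc.prems(1) in simp)
  have "Ck_on k S (\<lambda>x. \<Sum>b\<in>B. \<beta> b (?f x v) *\<^sub>R ?g (f x) b)" for v
    by (intro Ck_on_sum[OF assms(2)] Ck_on_bilinear[OF assms(2) bounded_bilinear_scaleR]
        Ck_on_bounded_linear_compose[OF assms(2) coordinatesD(2)[OF co]] f g)
  moreover have "(\<Sum>b\<in>B. \<beta> b (?f x v) *\<^sub>R ?g (f x) b) = ?g (f x) (?f x v)" if "x \<in> S" for x v
    using linear_coordinates_expand[OF co has_derivative_linear[OF Ck_on_SucD[OF Suc.prems(1)]], of "f x" "?f x v"]
      that assms(4) by auto
  ultimately have "Ck_on k S (\<lambda>x. ?g (f x) (?f x v))" for v
    using Ck_on_cong[OF assms(2)] by (metis (no_types, lifting))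
  then show ?case using Ck_on_SucI[OF assms(2) d] by blast
qed

lemma smooth_onD: "smooth_on S f \<Longrightarrow> Ck_on k S f"
  by (simp add: smooth_on_def)

lemma smooth_on_has_derivative:
  "smooth_on S f \<Longrightarrow> x \<in> S \<Longrightarrow> (f has_derivative frechet_derivative f (at x)) (at x)"
  using Ck_on_SucD smooth_onD by blast

lemma smooth_on_derivative:
  "smooth_on S f \<Longrightarrow> smooth_on S (\<lambda>x. frechet_derivative f (at x) v)"
  unfolding smooth_on_def using Ck_on.simps(2) by blast

lemma smooth_on_imp_continuous_on: "smooth_on S f \<Longrightarrow> continuous_on S f"
  using smooth_onD[of S f 0] by simp

lemma smooth_on_compose:
  fixes f :: "'a::real_normed_vector \<Rightarrow> 'b::real_normed_vector"
    and g :: "'b \<Rightarrow> 'c::real_normed_vector"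
  assumes "coordinates (B :: 'b set) \<beta>" "open S" "open T" "f ` S \<subseteq> T" "smooth_on T g" "smooth_on S f"
  shows "smooth_on S (\<lambda>x. g (f x))"
  unfolding smooth_on_def
  using Ck_on_compose[OF assms(1-4) smooth_onD[OF assms(5)] smooth_onD[OF assms(6)]] by blast

lemma smooth_on_Pair:
  "open S \<Longrightarrow> smooth_on S f \<Longrightarrow> smooth_on S g \<Longrightarrow> smooth_on S (\<lambda>x. (f x, g x))"
  unfolding smooth_on_def using Ck_on_Pair by blast

lemma smooth_on_bounded_linear: "open S \<Longrightarrow> bounded_linear L \<Longrightarrow> smooth_on S L"
  unfolding smooth_on_def using Ck_on_bounded_linear by blast

lemma smooth_on_const: "open S \<Longrightarrow> smooth_on S (\<lambda>x. c)"
  unfolding smooth_on_def using Ck_on_const by blast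

text \<open>Restriction to the slice over u recovers h and its derivatives. The direct induction
  works without coordinates on either factor, which suits the reduced space with its dual
  components.\<close>

lemma Ck_on_snd_iff:
  fixes U :: "'a::real_normed_vector set" and h :: "'b::real_normed_vector \<Rightarrow> 'c::real_normed_vector"
  assumes U: "open U" "u \<in> U"
  shows "Ck_on k (U \<times> UNIV) (\<lambda>p. h (snd p)) \<longleftrightarrow> Ck_on k UNIV h"
proof (induction k arbitrary: h)
  case 0
  have "continuous_on UNIV h" if "continuous_on (U \<times> UNIV) (\<lambda>p. h (snd p))"
  proof -
    have "continuous_on UNIV (\<lambda>x::'b. (u, x))" by (intro continuous_on_Pair continuous_on_const continuous_on_id)
    from continuous_on_compose2[OF that this] U(2) show ?thesis by auto
  qed
  moreover have "continuous_on (U \<times> UNIV) (\<lambda>p. h (snd p))" if "continuous_on UNIV h"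
    by (rule continuous_on_compose2[OF that continuous_on_snd[OF continuous_on_id]]) simp
  ultimately show ?case by auto
next
  case (Suc k)
  have op: "open (U \<times> (UNIV :: 'b set))" using U by (simp add: open_Times)
  have hd: "(h has_derivative (\<lambda>v. D (0, v))) (at x)"
    if "((\<lambda>p. h (snd p)) has_derivative D) (at (u, x))" for D x
  proof -
    have "((\<lambda>y. (u, y)) has_derivative (\<lambda>v. (0, v))) (at x)" by (auto intro!: derivative_eq_intros)
    from has_derivative_compose[OF this that] show ?thesis by simp
  qed
  have dh: "((\<lambda>p. h (snd p)) has_derivative (\<lambda>w. D (snd w))) (at p)"
    if "(h has_derivative D) (at (snd p))" for D and p :: "'a \<times> 'b"
    by (rule has_derivative_compose[OF has_derivative_snd[OF has_derivative_ident] that])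
  show ?case
  proof
    assume L: "Ck_on (Suc k) (U \<times> UNIV) (\<lambda>p. h (snd p))"
    have d: "(h has_derivative frechet_derivative h (at x)) (at x)" for x
      using hd[OF Ck_on_SucD[OF L, of "(u, x)"]] U(2) frechet_derivative_works differentiableI by blast
    have "Ck_on k UNIV (\<lambda>x. frechet_derivative h (at x) v)" for v
    proof -
      have "Ck_on k (U \<times> UNIV) (\<lambda>p. frechet_derivative (\<lambda>p. h (snd p)) (at p) (0, v))" using L by simp
      then have "Ck_on k (U \<times> UNIV) (\<lambda>p. frechet_derivative h (at (snd p)) v)"
        by (rule Ck_on_cong[OF op, rotated]) (use frechet_derivative_at[OF dh[OF d]] in \<open>auto dest: fun_cong\<close>)
      then show ?thesis unfolding Suc.IH[of "\<lambda>x. frechet_derivative h (at x) v"] .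
    qed
    then show "Ck_on (Suc k) UNIV h" by (intro Ck_on_SucI[OF open_UNIV d])
  next
    assume R: "Ck_on (Suc k) UNIV h"
    have "Ck_on k (U \<times> UNIV) (\<lambda>p. frechet_derivative h (at (snd p)) v)" for v
      unfolding Suc.IH[of "\<lambda>x. frechet_derivative h (at x) v"] using R by simp
    then show "Ck_on (Suc k) (U \<times> UNIV) (\<lambda>p. h (snd p))"
      by (intro Ck_on_SucI[OF op dh[OF Ck_on_SucD[OF R]]]) auto
  qed
qed

lemma smooth_on_add: "open S \<Longrightarrow> smooth_on S f \<Longrightarrow> smooth_on S g \<Longrightarrow> smooth_on S (\<lambda>x. f x + g x)"
  unfolding smooth_on_def using Ck_on_add by blast

lemma smooth_on_sum:
  "open S \<Longrightarrow> (\<And>i. i \<in> I \<Longrightarrow> smooth_on S (f i)) \<Longrightarrow> smooth_on S (\<lambda>x. \<Sum>i\<in>I. f i x)"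
  by (simp add: smooth_on_def Ck_on_sum)

lemma smooth_on_bilinear:
  "open S \<Longrightarrow> bounded_bilinear b \<Longrightarrow> smooth_on S f \<Longrightarrow> smooth_on S g \<Longrightarrow> smooth_on S (\<lambda>x. b (f x) (g x))"
  by (simp add: smooth_on_def Ck_on_bilinear)

lemma smooth_on_bounded_linear_compose:
  "open S \<Longrightarrow> bounded_linear L \<Longrightarrow> smooth_on S f \<Longrightarrow> smooth_on S (\<lambda>x. L (f x))"
  by (simp add: smooth_on_def Ck_on_bounded_linear_compose)

lemma smooth_on_diff:
  assumes "open S" "smooth_on S f" "smooth_on S g"
  shows "smooth_on S (\<lambda>x. f x - g x)"
  using smooth_on_add[OF assms(1,2) smooth_on_bounded_linear_compose[OF assms(1)
      bounded_linear_minus[OF bounded_linear_ident] assms(3)]] by simp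

section \<open>Local solutions of ordinary differential equations\<close>

text \<open>The difference of two integrals starting at -e stands for the oriented integral from 0
  to t, so both signs of t are covered at once.\<close>

lemma norm_increment_integral_le:
  fixes f :: "real \<Rightarrow> 'a::banach"
  assumes f: "continuous_on {-e..e} f" and t: "\<bar>t\<bar> \<le> e"
    and B: "\<And>s. \<bar>s\<bar> \<le> e \<Longrightarrow> norm (f s) \<le> B"
  shows "norm (integral {-e..t} f - integral {-e..0} f) \<le> B * e"
proof -
  have e0: "e \<ge> 0" and B0: "B \<ge> 0" using t B[OF t] norm_ge_zero order_trans by (auto, blast)
  have int: "f integrable_on {-e..s}" if "s \<le> e" for s
    by (intro integrable_continuous_real continuous_on_subset[OF f]) (use that in auto)
  have *: "norm (integral {-e..b} f - integral {-e..a} f) \<le> B * e"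
    if "-e \<le> a" "a \<le> b" "b \<le> e" "b - a \<le> e" for a b
  proof -
    have "integral {-e..a} f + integral {a..b} f = integral {-e..b} f"
      by (rule Henstock_Kurzweil_Integration.integral_combine[OF _ _ int]) (use that in auto)
    then have "norm (integral {-e..b} f - integral {-e..a} f) = norm (integral {a..b} f)"
      by (metis add_diff_cancel_left')
    also have "\<dots> \<le> B * (b - a)"
      by (rule integral_bound[OF \<open>a \<le> b\<close> continuous_on_subset[OF f]]) (use that in \<open>auto intro!: B\<close>)
    also have "\<dots> \<le> B * e" using B0 that by (intro mult_left_mono)
    finally show ?thesis .
  qed
  show ?thesis
  proof (cases "t \<ge> 0")
    case True
    then show ?thesis using *[of 0 t] t e0 by simp
  next
    case False
    then show ?thesis using *[of t 0] t e0 by (simp add: norm_minus_commute)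
  qed
qed

text \<open>Picard iteration as a contraction on the bounded continuous functions with values in the
  closed ball.\<close>

lemma lipschitz_ode_local_solution:
  fixes X :: "'a::banach \<Rightarrow> 'a"
  assumes r: "r > 0" and L0: "L \<ge> 0"
    and L: "\<And>x y. x \<in> cball x0 r \<Longrightarrow> y \<in> cball x0 r \<Longrightarrow> norm (X x - X y) \<le> L * norm (x - y)"
  obtains e u where "e > 0" "u 0 = x0"
    "\<And>t. \<bar>t\<bar> < e \<Longrightarrow> u t \<in> cball x0 r"
    "\<And>t. \<bar>t\<bar> < e \<Longrightarrow> (u has_vector_derivative X (u t)) (at t)"
proof -
  define M where "M = norm (X x0) + L * r"
  have M0: "M \<ge> 0" unfolding M_def using L0 r by simp
  have M: "norm (X x) \<le> M" if "x \<in> cball x0 r" for x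
  proof -
    have "norm (X x) \<le> norm (X x0) + norm (X x - X x0)" using norm_triangle_sub by blast
    also have "norm (X x - X x0) \<le> L * norm (x - x0)" using L that r by simp
    also have "L * norm (x - x0) \<le> L * r"
      using that L0 by (intro mult_left_mono) (auto simp: dist_norm norm_minus_commute)
    finally show ?thesis by (simp add: M_def)
  qed
  \<comment> \<open>The first bound gives M * e \<le> r, which keeps the iterates in the ball where
    M bounds X; the second gives L * e \<le> 1/2, the contraction factor. Adding 1 avoids division
    by zero.\<close>
  define e where "e = min (r / (M + 1)) (1 / (2 * (L + 1)))"
  have e0: "e > 0" using r M0 L0 by (simp add: e_def)
  have Me: "M * e \<le> r"
  proof -
    have "M * e \<le> (M + 1) * (r / (M + 1))" using M0 e0 by (intro mult_mono) (auto simp: e_def)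
    then show ?thesis using M0 by simp
  qed
  have Le: "L * e \<le> 1 / 2"
  proof -
    have "L * e \<le> (L + 1) * (1 / (2 * (L + 1)))" using L0 e0 by (intro mult_mono) (auto simp: e_def)
    also have "\<dots> = 1 / 2" using L0 by (simp add: field_simps)
    finally show ?thesis .
  qed
  have contX: "continuous_on (cball x0 r) X"
  proof (rule continuous_onI)
    fix x d assume x: "x \<in> cball x0 r" and "d > (0::real)"
    then show "\<exists>d'>0. \<forall>x'\<in>cball x0 r. dist x' x < d' \<longrightarrow> dist (X x') (X x) \<le> d"
    proof (intro exI[of _ "d / (L + 1)"] conjI ballI impI)
      fix x' assume x': "x' \<in> cball x0 r" and "dist x' x < d / (L + 1)"
      then have "(L + 1) * norm (x' - x) \<le> d" using L0 by (simp add: dist_norm field_simps)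
      moreover have "norm (X x' - X x) \<le> L * norm (x' - x)" using L[OF x' x] .
      ultimately show "dist (X x') (X x) \<le> d" unfolding dist_norm
        using norm_ge_zero[of "x' - x"] unfolding distrib_right by linarith
    qed (use \<open>d > 0\<close> L0 in auto)
  qed
  let ?S = "PiC UNIV (\<lambda>_. cball x0 r) :: (real \<Rightarrow>\<^sub>C 'a) set"
  \<comment> \<open>Clamping time to [-e, e] makes every iterate a bounded continuous function on
    the whole line, hence an element of the complete space
    \<open>real \<Rightarrow>\<^sub>C 'a\<close>.\<close>
  define cl where "cl t = max (-e) (min e t)" for t :: real
  have cl: "\<bar>cl t\<bar> \<le> e" for t using e0 by (auto simp: cl_def)
  have contcl: "continuous_on UNIV cl" unfolding cl_def by (intro continuous_intros)
  define J where "J u t = integral {-e..t} (\<lambda>s. X (apply_bcontfun u s)) - integral {-e..0} (\<lambda>s. X (apply_bcontfun u s))"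
    for u :: "real \<Rightarrow>\<^sub>C 'a" and t
  define F where "F u t = x0 + J u (cl t)" for u t
  have contXu: "continuous_on T (\<lambda>s. X (apply_bcontfun u s))" if "u \<in> ?S" for u T
    by (rule continuous_on_compose2[OF contX continuous_on_apply_bcontfun])
       (use that in \<open>auto simp: mem_PiC_iff Pi_def\<close>)
  have J: "norm (J u t) \<le> r" if "u \<in> ?S" "\<bar>t\<bar> \<le> e" for u t
  proof -
    have "norm (J u t) \<le> M * e" unfolding J_def
      by (rule norm_increment_integral_le[OF contXu[OF that(1)] that(2)])
         (use that in \<open>auto intro!: M simp: mem_PiC_iff Pi_def\<close>)
    with Me show ?thesis by simp
  qed
  have der: "((\<lambda>t. x0 + J u t) has_vector_derivative X (apply_bcontfun u t)) (at t within {-e..e})"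
    if "u \<in> ?S" "t \<in> {-e..e}" for u t
    unfolding J_def
    by (rule derivative_eq_intros integral_has_vector_derivative[OF contXu[OF that(1)] that(2)] refl)+ simp
  have contF: "continuous_on UNIV (F u)" if "u \<in> ?S" for u
  proof -
    have "continuous_on {-e..e} (\<lambda>t. x0 + J u t)"
      using has_vector_derivative_continuous[OF der[OF that]]
      by (simp add: continuous_on_eq_continuous_within)
    then show ?thesis unfolding F_def
      by (rule continuous_on_compose2[OF _ contcl]) (use cl in \<open>auto simp: abs_le_iff minus_le_iff\<close>)
  qed
  have FS: "F u t \<in> cball x0 r" if "u \<in> ?S" for u t
    using J[OF that cl] by (simp add: F_def dist_norm)
  have Fb: "F u \<in> bcontfun" if "u \<in> ?S" for u
    unfolding bcontfun_def using contF[OF that] bounded_subset[OF bounded_cball] FS[OF that] by blast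
  define \<Phi> where "\<Phi> u = Bcontfun (F u)" for u
  have ap: "apply_bcontfun (\<Phi> u) = F u" if "u \<in> ?S" for u
    unfolding \<Phi>_def using Bcontfun_inverse[OF Fb[OF that]] .
  have "\<exists>!u\<in>?S. \<Phi> u = u"
  proof (rule Banach_fix[where c = "1/2"])
    have "closed ?S" by (rule closed_PiC) simp
    then show "complete ?S" using complete_eq_closed by blast
    have "const_bcontfun x0 \<in> ?S" using r by (simp add: mem_PiC_iff)
    then show "?S \<noteq> {}" by blast
    show "\<Phi> ` ?S \<subseteq> ?S" using ap FS by (auto simp: mem_PiC_iff)
    fix u v assume uv: "u \<in> ?S" "v \<in> ?S"
    show "dist (\<Phi> u) (\<Phi> v) \<le> 1 / 2 * dist u v"
    proof (rule dist_bound)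
      fix t
      let ?f = "\<lambda>s. X (apply_bcontfun u s)" and ?g = "\<lambda>s. X (apply_bcontfun v s)"
      have int: "?f integrable_on {-e..s}" "?g integrable_on {-e..s}" for s
        using uv by (auto intro!: integrable_continuous_real contXu)
      have "J u s - J v s = integral {-e..s} (\<lambda>s. ?f s - ?g s) - integral {-e..0} (\<lambda>s. ?f s - ?g s)" for s
        unfolding J_def integral_diff[OF int] by simp
      moreover have "norm (integral {-e..cl t} (\<lambda>s. ?f s - ?g s) - integral {-e..0} (\<lambda>s. ?f s - ?g s))
          \<le> (L * dist u v) * e"
      proof (rule norm_increment_integral_le[OF _ cl])
        show "continuous_on {-e..e} (\<lambda>s. ?f s - ?g s)" using uv by (intro continuous_on_diff contXu) auto
        fix s
        have "norm (?f s - ?g s) \<le> L * norm (apply_bcontfun u s - apply_bcontfun v s)"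
          using uv by (intro L) (auto simp: mem_PiC_iff Pi_def)
        also have "\<dots> \<le> L * dist u v" using dist_bounded[of u s v] L0 by (intro mult_left_mono) (auto simp: dist_norm)
        finally show "norm (?f s - ?g s) \<le> L * dist u v" .
      qed
      ultimately have "norm (J u (cl t) - J v (cl t)) \<le> (L * e) * dist u v" by (simp add: mult_ac)
      also have "\<dots> \<le> 1 / 2 * dist u v" using Le by (intro mult_right_mono) auto
      finally show "dist (apply_bcontfun (\<Phi> u) t) (apply_bcontfun (\<Phi> v) t) \<le> 1 / 2 * dist u v"
        using uv ap by (simp add: F_def dist_norm)
    qed
  qed auto
  then obtain u where u: "u \<in> ?S" "\<Phi> u = u" by blast
  have ut: "apply_bcontfun u t = x0 + J u t" if "\<bar>t\<bar> \<le> e" for t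
  proof -
    have "cl t = t" using that by (auto simp: cl_def abs_le_iff)
    then show ?thesis using ap[OF u(1)] u(2) by (simp add: F_def)
  qed
  show thesis
  proof
    show "e > 0" by fact
    show "apply_bcontfun u 0 = x0" using ut[of 0] e0 by (simp add: J_def)
    fix t assume t: "\<bar>t\<bar> < e"
    show "apply_bcontfun u t \<in> cball x0 r" using u(1) by (auto simp: mem_PiC_iff Pi_def)
    have "((\<lambda>t. x0 + J u t) has_vector_derivative X (apply_bcontfun u t)) (at t within {-e..e})"
      by (rule der[OF u(1)]) (use t in auto)
    then have "((\<lambda>t. x0 + J u t) has_vector_derivative X (apply_bcontfun u t)) (at t)"
      using t at_within_interior[of t "{-e..e}"] by (simp add: abs_less_iff)
    then show "(apply_bcontfun u has_vector_derivative X (apply_bcontfun u t)) (at t)"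
      by (rule has_vector_derivative_transform_within_open[where S = "{-e<..<e}"])
         (use t ut in \<open>auto simp: abs_less_iff\<close>)
  qed
qed

text \<open>The mean value inequality on a small closed ball, which is convex, once the operator
  norm of the derivative is bounded there.\<close>

lemma smooth_on_locally_lipschitz:
  fixes X :: "'a::real_normed_vector \<Rightarrow> 'b::real_normed_vector"
  assumes co: "coordinates (B :: 'a set) \<beta>" and S: "open S" and X: "smooth_on S X" and x: "x0 \<in> S"
  obtains r L where "r > 0" "cball x0 r \<subseteq> S" "L \<ge> 0"
    "\<And>x y. x \<in> cball x0 r \<Longrightarrow> y \<in> cball x0 r \<Longrightarrow> norm (X x - X y) \<le> L * norm (x - y)"
proof -
  let ?D = "\<lambda>x. frechet_derivative X (at x)"
  obtain r0 where r0: "r0 > 0" "cball x0 r0 \<subseteq> S" using S x open_contains_cball by blast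
  \<comment> \<open>A majorant of the operator norm that is visibly continuous in x: it involves the
    derivative only in the finitely many directions b, and \<open>smooth_on\<close> gives continuity
    direction by direction.\<close>
  define N where "N x = (\<Sum>b\<in>B. onorm (\<beta> b) * norm (?D x b))" for x
  have "continuous_on S N" unfolding N_def
    using smooth_on_imp_continuous_on[OF smooth_on_derivative[OF X]]
    by (intro continuous_intros) auto
  then have "isCont N x0" using S x continuous_on_eq_continuous_at by blast
  then have "eventually (\<lambda>x. N x < N x0 + 1) (at x0)"
    unfolding isCont_def by (rule order_tendstoD) simp
  then obtain d where d: "d > 0" "\<And>x. x \<noteq> x0 \<Longrightarrow> dist x x0 < d \<Longrightarrow> N x < N x0 + 1"
    unfolding eventually_at by auto
  \<comment> \<open>Half of d, since continuity controls N on the open ball of radius d while a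
    closed ball is required.\<close>
  define r where "r = min r0 (d / 2)"
  have r: "r > 0" using r0 d by (simp add: r_def)
  have sub: "cball x0 r \<subseteq> S" using r0 by (auto simp: r_def)
  have Nb: "N x \<le> N x0 + 1" if "x \<in> cball x0 r" for x
    using d(2)[of x] that d(1) by (cases "x = x0") (auto simp: r_def dist_commute)
  have N0: "N x0 \<ge> 0" unfolding N_def
    by (intro sum_nonneg mult_nonneg_nonneg onorm_pos_le coordinatesD(2)[OF co]) auto
  have on: "onorm (?D x) \<le> N x0 + 1" if "x \<in> cball x0 r" for x
  proof (rule onorm_bound)
    show "0 \<le> N x0 + 1" using N0 by simp
    fix v
    have "?D x v = (\<Sum>b\<in>B. \<beta> b v *\<^sub>R ?D x b)"
      by (rule linear_coordinates_expand[OF co has_derivative_linear[OF smooth_on_has_derivative[OF X]]])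
         (use that sub in auto)
    then have "norm (?D x v) \<le> (\<Sum>b\<in>B. norm (\<beta> b v *\<^sub>R ?D x b))" using norm_sum by metis
    also have "\<dots> \<le> (\<Sum>b\<in>B. onorm (\<beta> b) * norm v * norm (?D x b))"
      unfolding norm_scaleR
      using onorm[OF coordinatesD(2)[OF co]] by (intro sum_mono mult_right_mono) auto
    also have "\<dots> = N x * norm v" by (simp add: N_def sum_distrib_left mult_ac)
    also have "\<dots> \<le> (N x0 + 1) * norm v" using Nb[OF that] by (intro mult_right_mono) auto
    finally show "norm (?D x v) \<le> (N x0 + 1) * norm v" .
  qed
  show thesis
  proof (rule that[OF r sub])
    show "N x0 + 1 \<ge> 0" using N0 by simp
    fix x y assume "x \<in> cball x0 r" "y \<in> cball x0 r"
    then show "norm (X x - X y) \<le> (N x0 + 1) * norm (x - y)"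
      by (rule_tac differentiable_bound[OF convex_cball has_derivative_at_withinI[OF smooth_on_has_derivative[OF X]] on])
         (use sub in auto)
  qed
qed

section \<open>Derivatives in charts\<close>

text \<open>The chart axioms of \<open>smooth_manifold\<close> detached from an atlas, so that
  product charts and the identity chart of a vector space fall under the same lemmas.\<close>

definition is_chart :: "('p::topological_space, 'v::real_normed_vector) chart \<Rightarrow> bool" where
  "is_chart c \<longleftrightarrow> open (cdom c) \<and> open (cmap c ` cdom c) \<and>
     homeomorphism (cdom c) (cmap c ` cdom c) (cmap c) (cinv c)"

lemma is_chartD:
  assumes "is_chart c"
  shows "open (cdom c)" "open (cmap c ` cdom c)"
    "p \<in> cdom c \<Longrightarrow> cinv c (cmap c p) = p"
    "x \<in> cmap c ` cdom c \<Longrightarrow> cmap c (cinv c x) = x"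
    "x \<in> cmap c ` cdom c \<Longrightarrow> cinv c x \<in> cdom c"
    "continuous_on (cdom c) (cmap c)" "continuous_on (cmap c ` cdom c) (cinv c)"
  using assms unfolding is_chart_def homeomorphism_def by auto

lemma is_chart_isCont:
  fixes c :: "('p::t2_space, 'v::real_normed_vector) chart"
  assumes "is_chart c" "p \<in> cdom c"
  shows "isCont (cmap c) p" "isCont (cinv c) (cmap c p)"
  using assms is_chartD[OF assms(1)] continuous_on_eq_continuous_at by blast+

lemma open_chart_image_Int:
  assumes c: "is_chart c" and "open T"
  shows "open (cmap c ` (cdom c \<inter> T))"
proof -
  have "cmap c ` (cdom c \<inter> T) = cmap c ` cdom c \<inter> cinv c -` T"
    using is_chartD(3,4,5)[OF c] by (auto simp: image_iff)
  also have "open \<dots>"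
    using continuous_open_preimage[OF is_chartD(7)[OF c] is_chartD(2)[OF c] assms(2)] .
  finally show ?thesis .
qed

lemma is_chart_identity: "is_chart (UNIV, id)"
proof -
  have "cinv (UNIV, id) = (id :: 'a \<Rightarrow> 'a)" by (auto simp: cinv_def inv_into_f_f)
  then show ?thesis by (simp add: is_chart_def homeomorphism_def continuous_on_id)
qed

lemma cinv_identity [simp]: "cinv (UNIV, id) = id" "cinv (UNIV, \<lambda>x. x) = id"
  by (auto simp: cinv_def inv_into_f_f id_def[symmetric])

text \<open>Off the chart image the value of \<open>inv_into\<close> is unspecified, so the inverse
  splits into factors only for points of both images.\<close>

lemma cinv_prod_chart:
  assumes "is_chart c" "is_chart d" "x \<in> cmap c ` cdom c" "y \<in> cmap d ` cdom d"
  shows "cinv (prod_chart c d) (x, y) = (cinv c x, cinv d y)"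
proof -
  have "inj_on (map_prod (cmap c) (cmap d)) (cdom c \<times> cdom d)"
    using is_chartD(3)[OF assms(1)] is_chartD(3)[OF assms(2)]
    by (auto intro!: inj_onI) metis+
  then have "inv_into (cdom c \<times> cdom d) (map_prod (cmap c) (cmap d))
      (map_prod (cmap c) (cmap d) (cinv c x, cinv d y)) = (cinv c x, cinv d y)"
    by (rule inv_into_f_f)
       (use is_chartD(5)[OF assms(1,3)] is_chartD(5)[OF assms(2,4)] in auto)
  then show ?thesis
    using is_chartD(4)[OF assms(1,3)] is_chartD(4)[OF assms(2,4)]
    by (simp add: cinv_def[of "prod_chart c d"]) (simp add: prod_chart_def)
qed

lemma is_chart_prod_chart:
  assumes c: "is_chart c" and d: "is_chart d"
  shows "is_chart (prod_chart c d)"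
proof -
  have im: "cmap (prod_chart c d) ` cdom (prod_chart c d) = cmap c ` cdom c \<times> cmap d ` cdom d"
    by (auto simp: prod_chart_def image_iff)
  have "homeomorphism (cdom c \<times> cdom d) (cmap c ` cdom c \<times> cmap d ` cdom d)
      (cmap (prod_chart c d)) (cinv (prod_chart c d))"
  proof (rule homeomorphismI)
    have "continuous_on (cdom c \<times> cdom d) (\<lambda>z. (cmap c (fst z), cmap d (snd z)))"
      by (intro continuous_on_Pair continuous_on_compose2[OF is_chartD(6)[OF c]]
          continuous_on_compose2[OF is_chartD(6)[OF d]] continuous_on_fst continuous_on_snd continuous_on_id) auto
    then show "continuous_on (cdom c \<times> cdom d) (cmap (prod_chart c d))"
      by (simp add: prod_chart_def map_prod_def case_prod_beta')
    have "continuous_on (cmap c ` cdom c \<times> cmap d ` cdom d) (\<lambda>z. (cinv c (fst z), cinv d (snd z)))"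
      by (intro continuous_on_Pair continuous_on_compose2[OF is_chartD(7)[OF c]]
          continuous_on_compose2[OF is_chartD(7)[OF d]] continuous_on_fst continuous_on_snd continuous_on_id) auto
    then show "continuous_on (cmap c ` cdom c \<times> cmap d ` cdom d) (cinv (prod_chart c d))"
      by (rule continuous_on_eq) (auto simp: cinv_prod_chart[OF c d])
    show "cmap (prod_chart c d) ` (cdom c \<times> cdom d) \<subseteq> cmap c ` cdom c \<times> cmap d ` cdom d"
      by (auto simp: prod_chart_def)
    show "cinv (prod_chart c d) ` (cmap c ` cdom c \<times> cmap d ` cdom d) \<subseteq> cdom c \<times> cdom d"
      by (auto simp: cinv_prod_chart[OF c d] is_chartD(3)[OF c] is_chartD(3)[OF d])
    show "cinv (prod_chart c d) (cmap (prod_chart c d) z) = z" if "z \<in> cdom c \<times> cdom d" for z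
      using that by (auto simp: prod_chart_def cinv_prod_chart[OF c d, unfolded prod_chart_def]
          is_chartD(3)[OF c] is_chartD(3)[OF d])
    show "cmap (prod_chart c d) (cinv (prod_chart c d) z) = z"
      if "z \<in> cmap c ` cdom c \<times> cmap d ` cdom d" for z
      using that by (auto simp: prod_chart_def cinv_prod_chart[OF c d, unfolded prod_chart_def]
          is_chartD(3)[OF c] is_chartD(3)[OF d])
  qed
  then show ?thesis
    unfolding is_chart_def im using is_chartD(1,2)[OF c] is_chartD(1,2)[OF d]
    by (auto simp: prod_chart_def intro: open_Times)
qed

text \<open>A tangent map between arbitrary charts, stated as a relation so that existence is part
  of it. Continuity of f at p is included because the coordinate expression alone does not force f
  to stay in \<open>cdom d\<close> near p, and outside that domain \<open>cmap d\<close> says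
  nothing about f.\<close>

definition chart_derivative ::
  "('p::t2_space, 'v::real_normed_vector) chart \<Rightarrow> ('q::t2_space, 'w::real_normed_vector) chart \<Rightarrow>
   ('p \<Rightarrow> 'q) \<Rightarrow> 'p \<Rightarrow> ('v \<Rightarrow> 'w) \<Rightarrow> bool" where
  "chart_derivative c d f p D \<longleftrightarrow> p \<in> cdom c \<and> f p \<in> cdom d \<and> isCont f p \<and>
     ((\<lambda>x. cmap d (f (cinv c x))) has_derivative D) (at (cmap c p))"

lemma chart_derivative_unique:
  "chart_derivative c d f p D \<Longrightarrow> chart_derivative c d f p D' \<Longrightarrow> D = D'"
  unfolding chart_derivative_def using has_derivative_unique by blast

lemma chart_derivative_linear: "chart_derivative c d f p D \<Longrightarrow> bounded_linear D"
  unfolding chart_derivative_def using has_derivative_bounded_linear by blast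

lemma chart_derivative_frechet:
  "chart_derivative c d f p D \<Longrightarrow> frechet_derivative (cmap d \<circ> f \<circ> cinv c) (at (cmap c p)) = D"
  unfolding chart_derivative_def comp_def using frechet_derivative_at by force

lemma isCont_eventually:
  "isCont f p \<Longrightarrow> open T \<Longrightarrow> f p \<in> T \<Longrightarrow> eventually (\<lambda>x. f x \<in> T) (at p)"
  unfolding isCont_def by (rule topological_tendstoD)

lemma chart_derivative_transform:
  assumes c: "is_chart c" and f: "chart_derivative c d f p D"
    and ev: "eventually (\<lambda>x. f x = g x) (nhds p)"
  shows "chart_derivative c d g p D"
proof -
  have p: "p \<in> cdom c" and fp: "f p = g p" using f ev eventually_nhds_x_imp_x
    by (auto simp: chart_derivative_def)
  have "isCont g p"
    using f isCont_cong[OF ev] by (simp add: chart_derivative_def)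
  moreover have "eventually (\<lambda>x. f (cinv c x) = g (cinv c x)) (at (cmap c p))"
  proof -
    obtain T where T: "open T" "p \<in> T" "\<And>x. x \<in> T \<Longrightarrow> f x = g x"
      using ev unfolding eventually_nhds by blast
    have "eventually (\<lambda>x. cinv c x \<in> T) (at (cmap c p))"
      by (rule isCont_eventually[OF is_chart_isCont(2)[OF c p] T(1)])
         (simp add: T is_chartD(3)[OF c p])
    then show ?thesis by eventually_elim (rule T(3))
  qed
  then have "((\<lambda>x. cmap d (g (cinv c x))) has_derivative D) (at (cmap c p))"
    using f unfolding chart_derivative_def
    by (rule_tac has_derivative_transform_eventually[where f = "\<lambda>x. cmap d (f (cinv c x))"])
       (auto elim!: eventually_mono simp: is_chartD(3)[OF c p] fp)
  ultimately show ?thesis using f fp by (simp add: chart_derivative_def)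
qed

lemma chart_derivative_compose:
  assumes c: "is_chart c" and d: "is_chart d"
    and f: "chart_derivative c d f p D" and g: "chart_derivative d e g (f p) E"
  shows "chart_derivative c e (\<lambda>x. g (f x)) p (\<lambda>v. E (D v))"
proof -
  let ?x = "cmap c p"
  have p: "p \<in> cdom c" "f p \<in> cdom d" using f by (auto simp: chart_derivative_def)
  have ip: "cinv c ?x = p" using is_chartD(3)[OF c p(1)] .
  have fd: "((\<lambda>x. cmap d (f (cinv c x))) has_derivative D) (at ?x)"
    and gd: "((\<lambda>x. cmap e (g (cinv d x))) has_derivative E) (at (cmap d (f (cinv c ?x))))"
    using f g ip by (auto simp: chart_derivative_def)
  have "isCont (\<lambda>x. f (cinv c x)) ?x"
    by (rule isCont_o2[OF is_chart_isCont(2)[OF c p(1)]]) (use f ip in \<open>simp add: chart_derivative_def\<close>)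
  \<comment> \<open>This is what the continuity clause is for: near the base point the middle chart
    d can be inserted and cancelled.\<close>
  then have "eventually (\<lambda>x. f (cinv c x) \<in> cdom d) (at ?x)"
    by (rule isCont_eventually) (use is_chartD(1)[OF d] p ip in auto)
  then have "eventually (\<lambda>x. cmap e (g (cinv d (cmap d (f (cinv c x))))) = cmap e (g (f (cinv c x)))) (at ?x)"
    by eventually_elim (simp add: is_chartD(3)[OF d])
  then have "((\<lambda>x. cmap e (g (f (cinv c x)))) has_derivative (\<lambda>v. E (D v))) (at ?x)"
    by (rule has_derivative_transform_eventually[OF has_derivative_compose[OF fd gd]])
       (simp_all add: ip is_chartD(3)[OF d] p)
  moreover have "isCont (\<lambda>x. g (f x)) p"
    using f g isCont_o2[of p f g] by (simp add: chart_derivative_def)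
  ultimately show ?thesis using p g by (simp add: chart_derivative_def)
qed

lemma chart_derivative_id:
  assumes c: "is_chart c" and p: "p \<in> cdom c"
  shows "chart_derivative c c (\<lambda>x. x) p (\<lambda>v. v)"
proof -
  have "((\<lambda>x. cmap c (cinv c x)) has_derivative (\<lambda>v. v)) (at (cmap c p))"
    by (rule has_derivative_transform_within_open[OF has_derivative_ident is_chartD(2)[OF c]])
       (use p in \<open>auto simp: is_chartD(3)[OF c]\<close>)
  then show ?thesis using p by (simp add: chart_derivative_def)
qed

lemma chart_derivative_const:
  "p \<in> cdom c \<Longrightarrow> q \<in> cdom d \<Longrightarrow> chart_derivative c d (\<lambda>x. q) p (\<lambda>v. 0)"
  by (simp add: chart_derivative_def)

lemma chart_derivative_Pair:
  assumes "chart_derivative b c f p D" "chart_derivative b d g p E"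
  shows "chart_derivative b (prod_chart c d) (\<lambda>x. (f x, g x)) p (\<lambda>v. (D v, E v))"
  using assms unfolding chart_derivative_def prod_chart_def
  by (auto intro: has_derivative_Pair isCont_Pair)

lemma chart_derivative_identity_charts:
  "chart_derivative (UNIV, id) (UNIV, id) f p D \<longleftrightarrow> (f has_derivative D) (at p)"
  unfolding chart_derivative_def using has_derivative_continuous by auto

lemma smooth_map_open_domain:
  assumes "is_chart c" "is_chart d" "continuous_on UNIV f"
  shows "open (cmap c ` (cdom c \<inter> f -` cdom d))"
  by (rule open_chart_image_Int[OF assms(1) open_vimage[OF is_chartD(1)[OF assms(2)] assms(3)]])

lemma smooth_map_chart_derivative:
  fixes M :: "('p::t2_space, 'v::real_normed_vector) manifold"
    and N :: "('q::t2_space, 'w::real_normed_vector) manifold"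
  assumes f: "smooth_map M N f" and "c \<in> atlas M" "d \<in> atlas N"
    and p: "p \<in> cdom c" "f p \<in> cdom d"
  shows "chart_derivative c d f p (frechet_derivative (cmap d \<circ> f \<circ> cinv c) (at (cmap c p)))"
proof -
  have "(cmap d \<circ> f \<circ> cinv c has_derivative
      frechet_derivative (cmap d \<circ> f \<circ> cinv c) (at (cmap c p))) (at (cmap c p))"
    by (rule smooth_on_has_derivative[of "cmap c ` (cdom c \<inter> f -` cdom d)"])
       (use assms in \<open>auto simp: smooth_map_def\<close>)
  then show ?thesis
    using assms unfolding chart_derivative_def smooth_map_def
    by (simp add: comp_def continuous_on_eq_continuous_at)
qed

lemma smooth_map_vector_manifold_iff:
  "smooth_map vector_manifold vector_manifold h \<longleftrightarrow> smooth_on UNIV h"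
  using smooth_on_imp_continuous_on[of UNIV h]
  by (auto simp: smooth_map_def vector_manifold_def comp_def)

section \<open>Partial derivatives on the reduced space\<close>

lemma dual_separates_points:
  assumes "coordinates (B :: 'a::real_normed_vector set) \<beta>"
    and "\<And>\<alpha> :: 'a \<Rightarrow>\<^sub>L real. blinfun_apply \<alpha> v = blinfun_apply \<alpha> w"
  shows "v = w"
proof -
  have "\<beta> b v = \<beta> b w" if "b \<in> B" for b
    using assms(2)[of "Blinfun (\<beta> b)"] coordinatesD(2)[OF assms(1) that]
    by (simp add: bounded_linear_Blinfun_apply)
  then have "(\<Sum>b\<in>B. \<beta> b v *\<^sub>R b) = (\<Sum>b\<in>B. \<beta> b w *\<^sub>R b)" by simp
  then show ?thesis using coordinatesD(3)[OF assms(1)] by simp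
qed

text \<open>The finite-dimensional identification of the bidual. The explicit vector, with
  coefficients \<open>L (Blinfun (\<beta> b))\<close>, removes the description from
  \<open>delta_mu\<close> and \<open>delta_nu\<close> and shows how they depend on the base
  point.\<close>

lemma linear_on_dual_is_evaluation:
  assumes co: "coordinates (B :: 'a::real_normed_vector set) \<beta>"
    and "linear (L :: ('a \<Rightarrow>\<^sub>L real) \<Rightarrow> real)"
  shows "(THE v. \<forall>\<alpha>. L \<alpha> = blinfun_apply \<alpha> v) = (\<Sum>b\<in>B. L (Blinfun (\<beta> b)) *\<^sub>R b)"
    and "blinfun_apply \<alpha> (\<Sum>b\<in>B. L (Blinfun (\<beta> b)) *\<^sub>R b) = L \<alpha>"
proof -
  have eval: "blinfun_apply \<alpha> (\<Sum>b\<in>B. L (Blinfun (\<beta> b)) *\<^sub>R b) = L \<alpha>" for \<alpha>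
  proof -
    have "L \<alpha> = L (\<Sum>b\<in>B. blinfun_apply \<alpha> b *\<^sub>R Blinfun (\<beta> b))"
      using coordinates_dual[OF co, of \<alpha>] by simp
    also have "\<dots> = (\<Sum>b\<in>B. blinfun_apply \<alpha> b *\<^sub>R L (Blinfun (\<beta> b)))"
      by (simp add: linear_sum[OF assms(2)] linear_scale[OF assms(2)])
    finally show ?thesis by (simp add: blinfun.sum_right blinfun.scaleR_right mult.commute)
  qed
  then show "blinfun_apply \<alpha> (\<Sum>b\<in>B. L (Blinfun (\<beta> b)) *\<^sub>R b) = L \<alpha>" .
  show "(THE v. \<forall>\<alpha>. L \<alpha> = blinfun_apply \<alpha> v) = (\<Sum>b\<in>B. L (Blinfun (\<beta> b)) *\<^sub>R b)"
    using eval by (intro the_equality dual_separates_points[OF co]) simp_all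
qed

lemma partial_has_derivative:
  fixes h :: "'v::banach reduced_space \<Rightarrow> real"
  assumes h: "(h has_derivative D) (at (\<xi>, \<mu>, \<nu>))"
  shows "((\<lambda>x. h (x, \<mu>, \<nu>)) has_derivative (\<lambda>v. D (v, 0, 0))) (at \<xi>)"
    "((\<lambda>m. h (\<xi>, m, \<nu>)) has_derivative (\<lambda>\<alpha>. D (0, \<alpha>, 0))) (at \<mu>)"
    "((\<lambda>n. h (\<xi>, \<mu>, n)) has_derivative (\<lambda>\<alpha>. D (0, 0, \<alpha>))) (at \<nu>)"
proof -
  have "((\<lambda>x. (x, \<mu>, \<nu>)) has_derivative (\<lambda>v. (v, 0, 0))) (at \<xi>)"
    "((\<lambda>m. (\<xi>, m, \<nu>)) has_derivative (\<lambda>v. (0, v, 0))) (at \<mu>)"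
    "((\<lambda>n. (\<xi>, \<mu>, n)) has_derivative (\<lambda>v. (0, 0, v))) (at \<nu>)"
    by (auto intro!: derivative_eq_intros simp: zero_prod_def)
  then show "((\<lambda>x. h (x, \<mu>, \<nu>)) has_derivative (\<lambda>v. D (v, 0, 0))) (at \<xi>)"
    "((\<lambda>m. h (\<xi>, m, \<nu>)) has_derivative (\<lambda>\<alpha>. D (0, \<alpha>, 0))) (at \<mu>)"
    "((\<lambda>n. h (\<xi>, \<mu>, n)) has_derivative (\<lambda>\<alpha>. D (0, 0, \<alpha>))) (at \<nu>)"
    using has_derivative_compose h by blast+
qed

lemma delta_xi_eq:
  assumes h: "(h has_derivative D) (at (\<xi>, \<mu>, \<nu>))"
  shows "blinfun_apply (delta_xi h (\<xi>, \<mu>, \<nu>)) v = D (v, 0, 0)"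
proof -
  have "frechet_derivative (\<lambda>x. h (x, \<mu>, \<nu>)) (at \<xi>) = (\<lambda>v. D (v, 0, 0))"
    using frechet_derivative_at[OF partial_has_derivative(1)[OF h]] by simp
  then show ?thesis
    using bounded_linear_Blinfun_apply[OF has_derivative_bounded_linear[OF partial_has_derivative(1)[OF h]]]
    by (simp add: delta_xi_def)
qed

lemma delta_mu_nu_eq:
  assumes co: "coordinates (B :: 'v::banach set) \<beta>" and h: "(h has_derivative D) (at (\<xi>, \<mu>, \<nu>))"
  shows "delta_mu h (\<xi>, \<mu>, \<nu>) = (\<Sum>b\<in>B. D (0, Blinfun (\<beta> b), 0) *\<^sub>R b)"
    "delta_nu h (\<xi>, \<mu>, \<nu>) = (\<Sum>b\<in>B. D (0, 0, Blinfun (\<beta> b)) *\<^sub>R b)"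
    "blinfun_apply \<alpha> (delta_mu h (\<xi>, \<mu>, \<nu>)) = D (0, \<alpha>, 0)"
    "blinfun_apply \<alpha> (delta_nu h (\<xi>, \<mu>, \<nu>)) = D (0, 0, \<alpha>)"
proof -
  note p = partial_has_derivative[OF h]
  have "frechet_derivative (\<lambda>m. h (\<xi>, m, \<nu>)) (at \<mu>) = (\<lambda>\<alpha>. D (0, \<alpha>, 0))"
    "frechet_derivative (\<lambda>n. h (\<xi>, \<mu>, n)) (at \<nu>) = (\<lambda>\<alpha>. D (0, 0, \<alpha>))"
    using frechet_derivative_at[OF p(2)] frechet_derivative_at[OF p(3)] by simp_all
  then have *: "delta_mu h (\<xi>, \<mu>, \<nu>) = (THE v. \<forall>\<alpha>. D (0, \<alpha>, 0) = blinfun_apply \<alpha> v)"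
    "delta_nu h (\<xi>, \<mu>, \<nu>) = (THE v. \<forall>\<alpha>. D (0, 0, \<alpha>) = blinfun_apply \<alpha> v)"
    by (simp_all add: delta_mu_def delta_nu_def)
  show mu: "delta_mu h (\<xi>, \<mu>, \<nu>) = (\<Sum>b\<in>B. D (0, Blinfun (\<beta> b), 0) *\<^sub>R b)"
    unfolding * by (rule linear_on_dual_is_evaluation(1)[OF co has_derivative_linear[OF p(2)]])
  show nu: "delta_nu h (\<xi>, \<mu>, \<nu>) = (\<Sum>b\<in>B. D (0, 0, Blinfun (\<beta> b)) *\<^sub>R b)"
    unfolding * by (rule linear_on_dual_is_evaluation(1)[OF co has_derivative_linear[OF p(3)]])
  show "blinfun_apply \<alpha> (delta_mu h (\<xi>, \<mu>, \<nu>)) = D (0, \<alpha>, 0)"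
    unfolding mu by (rule linear_on_dual_is_evaluation(2)[OF co has_derivative_linear[OF p(2)]])
  show "blinfun_apply \<alpha> (delta_nu h (\<xi>, \<mu>, \<nu>)) = D (0, 0, \<alpha>)"
    unfolding nu by (rule linear_on_dual_is_evaluation(2)[OF co has_derivative_linear[OF p(3)]])
qed

text \<open>Each partial derivative is a finite sum of fixed vectors or functionals with directional
  derivatives of h as coefficients.\<close>

lemma smooth_on_delta:
  fixes h :: "'v::banach reduced_space \<Rightarrow> real"
  assumes co: "coordinates (B :: 'v set) \<beta>" and h: "smooth_on UNIV h"
  shows "smooth_on UNIV (delta_xi h)" "smooth_on UNIV (delta_mu h)" "smooth_on UNIV (delta_nu h)"
proof -
  let ?D = "\<lambda>x. frechet_derivative h (at x)"
  have D: "(h has_derivative ?D x) (at x)" for x using smooth_on_has_derivative[OF h] by blast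
  have s: "smooth_on UNIV (\<lambda>x. ?D x w *\<^sub>R c)" for w and c :: "'c::real_normed_vector"
    by (rule smooth_on_bounded_linear_compose[OF open_UNIV bounded_linear_scaleR_left smooth_on_derivative[OF h]])
  have "delta_xi h = (\<lambda>x. \<Sum>b\<in>B. ?D x (b, 0, 0) *\<^sub>R Blinfun (\<beta> b))"
  proof
    fix x :: "'v reduced_space"
    obtain \<xi> \<mu> \<nu> where x: "x = (\<xi>, \<mu>, \<nu>)" by (metis prod_cases3)
    show "delta_xi h x = (\<Sum>b\<in>B. ?D x (b, 0, 0) *\<^sub>R Blinfun (\<beta> b))"
      using coordinates_dual[OF co, of "delta_xi h x"] delta_xi_eq[OF D, of \<xi> \<mu> \<nu>] by (simp add: x)
  qed
  then show "smooth_on UNIV (delta_xi h)" using smooth_on_sum[OF open_UNIV s] by simp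
  have "delta_mu h = (\<lambda>x. \<Sum>b\<in>B. ?D x (0, Blinfun (\<beta> b), 0) *\<^sub>R b)"
    "delta_nu h = (\<lambda>x. \<Sum>b\<in>B. ?D x (0, 0, Blinfun (\<beta> b)) *\<^sub>R b)"
    using delta_mu_nu_eq(1,2)[OF co D] by (auto simp: fun_eq_iff)
  then show "smooth_on UNIV (delta_mu h)" "smooth_on UNIV (delta_nu h)"
    using smooth_on_sum[OF open_UNIV s] by simp_all
qed

context lie_group
begin

section \<open>One-parameter subgroups\<close>

lemma in_carrier [simp]: "x \<in> carrier G"
  by (simp add: carrier_UNIV)

lemma cancel_inv [simp]: "inv x \<otimes> (x \<otimes> y) = y" "x \<otimes> (inv x \<otimes> y) = y"
  by (simp_all add: m_assoc[symmetric])

lemma atlas_is_chart: "c \<in> atlas M \<Longrightarrow> is_chart c"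
  unfolding is_chart_def using open_chart_domain open_chart_image chart_homeomorphism by blast

lemma chart_at_is_chart [simp]: "is_chart (chart_at M p)"
  using atlas_is_chart chart_at_in_atlas by blast

lemma coordinates_exist: "\<exists>(B :: 'v set) \<beta>. coordinates B \<beta>"
  using finite_dim finite_span_imp_coordinates by blast

abbreviation identity_chart :: "('g, 'v) chart" where "identity_chart \<equiv> chart_at M \<one>"

section \<open>Derivatives of multiplication, translations, conjugation and inversion\<close>

abbreviation mult :: "'g \<times> 'g \<Rightarrow> 'g" where "mult \<equiv> \<lambda>(x, y). x \<otimes> y"

text \<open>Left and right translations have as derivatives the restrictions of this one map to
  vectors (0, v) and (v, 0), so all of them inherit their regularity from
  \<open>smooth_mult\<close>.\<close>

definition mult_derivative :: "('g, 'v) chart \<Rightarrow> ('g, 'v) chart \<Rightarrow> ('g, 'v) chart \<Rightarrow> 'g \<times> 'g \<Rightarrow> 'v \<times> 'v \<Rightarrow> 'v" where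
  "mult_derivative c d e p =
     frechet_derivative (cmap e \<circ> mult \<circ> cinv (prod_chart c d)) (at (cmap (prod_chart c d) p))"

lemma chart_derivative_mult:
  assumes "c \<in> atlas M" "d \<in> atlas M" "e \<in> atlas M" "x \<in> cdom c" "y \<in> cdom d" "x \<otimes> y \<in> cdom e"
  shows "chart_derivative (prod_chart c d) e mult (x, y) (mult_derivative c d e (x, y))"
  unfolding mult_derivative_def
proof (rule smooth_map_chart_derivative[OF smooth_mult])
  show "prod_chart c d \<in> atlas (prod_manifold M M)" using assms(1,2) by (simp add: prod_manifold_def del: split_paired_Ex) blast
qed (use assms in \<open>auto simp: prod_chart_def\<close>)

lemma continuous_mult: "continuous_on UNIV mult"
  using smooth_mult by (simp add: smooth_map_def)

lemma chart_derivative_left_mult: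
  assumes "b \<in> atlas M" "c \<in> atlas M" "e \<in> atlas M" "g \<in> cdom b" "x \<in> cdom c" "g \<otimes> x \<in> cdom e"
  shows "chart_derivative c e (\<lambda>h. g \<otimes> h) x (\<lambda>v. mult_derivative b c e (g, x) (0, v))"
  using chart_derivative_compose[OF atlas_is_chart[OF assms(2)]
      is_chart_prod_chart[OF atlas_is_chart[OF assms(1)] atlas_is_chart[OF assms(2)]]
      chart_derivative_Pair[OF chart_derivative_const chart_derivative_id]
      chart_derivative_mult, of x g e] assms
  by (simp add: atlas_is_chart)

lemma chart_derivative_right_mult:
  assumes "c \<in> atlas M" "e \<in> atlas M" "x \<in> cdom c" "x \<otimes> g \<in> cdom e"
  shows "chart_derivative c e (\<lambda>h. h \<otimes> g) x (\<lambda>v. mult_derivative c (chart_at M g) e (x, g) (v, 0))"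
  using chart_derivative_compose[OF atlas_is_chart[OF assms(1)]
      is_chart_prod_chart[OF atlas_is_chart[OF assms(1)] chart_at_is_chart]
      chart_derivative_Pair[OF chart_derivative_id chart_derivative_const]
      chart_derivative_mult, of x g g e] assms
  by (simp add: atlas_is_chart chart_at_in_atlas chart_at_covers)

lemma chart_derivative_right_translation:
  "chart_derivative identity_chart (chart_at M g) (\<lambda>h. h \<otimes> g) \<one> (right_translation_tangent G M g)"
proof -
  have "chart_derivative identity_chart (chart_at M g) (\<lambda>h. h \<otimes> g) \<one>
     (\<lambda>v. mult_derivative identity_chart (chart_at M g) (chart_at M g) (\<one>, g) (v, 0))" (is "chart_derivative _ _ _ _ ?D")
    by (rule chart_derivative_right_mult) (simp_all add: chart_at_in_atlas chart_at_covers)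
  moreover have "right_translation_tangent G M g = ?D"
    unfolding right_translation_tangent_def tangent_map_def
    using chart_derivative_frechet[OF calculation] by simp
  ultimately show ?thesis by simp
qed

text \<open>Right translation by \<open>inv g\<close> has a derivative S at g that is a two-sided
  inverse, by the chain rule and uniqueness of derivatives.\<close>

lemma right_translation_tangent_bij:
  "bounded_linear (right_translation_tangent G M g)" "bij (right_translation_tangent G M g)"
proof -
  let ?R = "right_translation_tangent G M g"
  show "bounded_linear ?R" using chart_derivative_linear[OF chart_derivative_right_translation] .
  obtain S where S: "chart_derivative (chart_at M g) identity_chart (\<lambda>h. h \<otimes> inv g) g S"
    using chart_derivative_right_mult[of "chart_at M g" identity_chart g "inv g"]
    by (auto simp: chart_at_in_atlas chart_at_covers)
  have "chart_derivative identity_chart identity_chart (\<lambda>h. (h \<otimes> g) \<otimes> inv g) \<one> (\<lambda>v. S (?R v))"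
    by (rule chart_derivative_compose[OF _ _ chart_derivative_right_translation]) (use S in simp_all)
  then have "chart_derivative identity_chart identity_chart (\<lambda>h. h) \<one> (\<lambda>v. S (?R v))"
    by (simp add: m_assoc)
  then have 1: "(\<lambda>v. S (?R v)) = (\<lambda>v. v)"
    using chart_derivative_id[OF _ chart_at_covers] chart_derivative_unique chart_at_is_chart by blast
  have "chart_derivative (chart_at M g) (chart_at M g) (\<lambda>h. (h \<otimes> inv g) \<otimes> g) g (\<lambda>v. ?R (S v))"
    by (rule chart_derivative_compose[OF _ _ S]) (use chart_derivative_right_translation in simp_all)
  then have "chart_derivative (chart_at M g) (chart_at M g) (\<lambda>h. h) g (\<lambda>v. ?R (S v))"
    by (simp add: m_assoc)
  then have 2: "(\<lambda>v. ?R (S v)) = (\<lambda>v. v)"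
    using chart_derivative_id[OF _ chart_at_covers] chart_derivative_unique chart_at_is_chart by blast
  show "bij ?R" by (rule o_bij[of S]) (use 1 2 in \<open>auto simp: fun_eq_iff\<close>)
qed

text \<open>Conjugation is left translation followed by right translation; a chart around
  \<open>inv g\<close> reads the intermediate point.\<close>

lemma chart_derivative_Ad:
  "chart_derivative identity_chart identity_chart (\<lambda>h. inv g \<otimes> h \<otimes> g) \<one> (Ad G M g)"
proof -
  obtain D where D: "chart_derivative identity_chart (chart_at M (inv g)) (\<lambda>h. inv g \<otimes> h) \<one> D"
    using chart_derivative_left_mult[of "chart_at M (inv g)" identity_chart "chart_at M (inv g)" "inv g" \<one>]
    by (auto simp: chart_at_in_atlas chart_at_covers)
  obtain E where E: "chart_derivative (chart_at M (inv g)) identity_chart (\<lambda>h. h \<otimes> g) (inv g) E"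
    using chart_derivative_right_mult[of "chart_at M (inv g)" identity_chart "inv g" g]
    by (auto simp: chart_at_in_atlas chart_at_covers)
  have *: "chart_derivative identity_chart identity_chart (\<lambda>h. inv g \<otimes> h \<otimes> g) \<one> (\<lambda>v. E (D v))"
    by (rule chart_derivative_compose[OF _ _ D]) (use E in simp_all)
  then have "Ad G M g = (\<lambda>v. E (D v))"
    unfolding Ad_def tangent_map_def using chart_derivative_frechet[OF *] by simp
  with * show ?thesis by simp
qed

text \<open>On each axis multiplication by the identity is the identity map; linearity joins the two
  axes.\<close>

lemma mult_derivative_one: "mult_derivative identity_chart identity_chart identity_chart (\<one>, \<one>) (v, w) = v + w"
proof -
  let ?c = identity_chart
  have D: "chart_derivative (prod_chart ?c ?c) ?c mult (\<one>, \<one>) (mult_derivative ?c ?c ?c (\<one>, \<one>))"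
    by (rule chart_derivative_mult) (simp_all add: chart_at_in_atlas chart_at_covers)
  have l: "linear (mult_derivative ?c ?c ?c (\<one>, \<one>))"
    using chart_derivative_linear[OF D] bounded_linear.linear by blast
  have id: "chart_derivative ?c ?c (\<lambda>h. h) \<one> (\<lambda>v. v)" by (simp add: chart_derivative_id chart_at_covers)
  have "(\<lambda>v. mult_derivative ?c ?c ?c (\<one>, \<one>) (0, v)) = (\<lambda>v. v)"
    using chart_derivative_left_mult[of ?c ?c ?c \<one> \<one>]
    by (intro chart_derivative_unique[OF _ id]) (simp add: chart_at_in_atlas chart_at_covers)
  moreover have "(\<lambda>v. mult_derivative ?c ?c ?c (\<one>, \<one>) (v, 0)) = (\<lambda>v. v)"
    using chart_derivative_right_mult[of ?c ?c \<one> \<one>]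
    by (intro chart_derivative_unique[OF _ id]) (simp add: chart_at_in_atlas chart_at_covers)
  moreover have "(v, w) = (v, 0) + (0, w)" by simp
  ultimately show ?thesis using linear_add[OF l] by metis
qed

text \<open>Differentiate \<open>h \<otimes> inv h = \<one>\<close> at the identity.\<close>

lemma chart_derivative_inverse_one: "chart_derivative identity_chart identity_chart (\<lambda>h. inv h) \<one> uminus"
proof -
  let ?c = identity_chart
  obtain D where D: "chart_derivative ?c ?c (\<lambda>h. inv h) \<one> D"
    using smooth_map_chart_derivative[OF smooth_inverse, of ?c ?c \<one>]
    by (auto simp: chart_at_in_atlas chart_at_covers)
  have "chart_derivative ?c ?c (\<lambda>h. mult (h, inv h)) \<one> (\<lambda>v. mult_derivative ?c ?c ?c (\<one>, \<one>) (v, D v))"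
    by (rule chart_derivative_compose[OF _ _ chart_derivative_Pair[OF chart_derivative_id D]])
       (use chart_derivative_mult[of ?c ?c ?c \<one> \<one>] in \<open>simp_all add: is_chart_prod_chart chart_at_in_atlas chart_at_covers\<close>)
  then have "chart_derivative ?c ?c (\<lambda>h. \<one>) \<one> (\<lambda>v. v + D v)" by (simp add: mult_derivative_one)
  then have "(\<lambda>v. v + D v) = (\<lambda>v. 0)"
    using chart_derivative_unique chart_derivative_const chart_at_covers by blast
  then have "D = uminus" by (metis add_eq_0_iff ext)
  with D show ?thesis by simp
qed

section \<open>Velocities at the identity and left logarithmic derivatives\<close>

text \<open>Differentiability is recorded at parameter 0 only, so that curves not yet known to be
  smooth can be handled.\<close>

definition velocity :: "(real \<Rightarrow> 'g) \<Rightarrow> 'v \<Rightarrow> bool" where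
  "velocity a \<xi> \<longleftrightarrow> a 0 = \<one> \<and> chart_derivative (UNIV, id) identity_chart a 0 (\<lambda>r. r *\<^sub>R \<xi>)"

lemma velocity_unique: "velocity a \<xi> \<Longrightarrow> velocity a \<eta> \<Longrightarrow> \<xi> = \<eta>"
  unfolding velocity_def using chart_derivative_unique by (metis scaleR_one)

lemma velocity_mult:
  assumes "velocity a \<xi>" "velocity b \<eta>"
  shows "velocity (\<lambda>r. a r \<otimes> b r) (\<xi> + \<eta>)"
proof -
  let ?c = identity_chart
  have "chart_derivative (UNIV, id) ?c (\<lambda>r. mult (a r, b r)) 0
      (\<lambda>r. mult_derivative ?c ?c ?c (\<one>, \<one>) (r *\<^sub>R \<xi>, r *\<^sub>R \<eta>))"
    by (rule chart_derivative_compose[OF is_chart_identity is_chart_prod_chart chart_derivative_Pair])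
       (use assms chart_derivative_mult[of ?c ?c ?c \<one> \<one>] in
        \<open>auto simp: velocity_def is_chart_prod_chart chart_at_in_atlas chart_at_covers\<close>)
  then show ?thesis using assms by (simp add: velocity_def mult_derivative_one scaleR_add_right)
qed

lemma velocity_compose:
  assumes "velocity a \<xi>" "chart_derivative identity_chart identity_chart f \<one> D" "f \<one> = \<one>"
  shows "velocity (\<lambda>r. f (a r)) (D \<xi>)"
proof -
  have "chart_derivative (UNIV, id) identity_chart (\<lambda>r. f (a r)) 0 (\<lambda>r. D (r *\<^sub>R \<xi>))"
    by (rule chart_derivative_compose[OF is_chart_identity chart_at_is_chart])
       (use assms in \<open>auto simp: velocity_def\<close>)
  moreover have "D (r *\<^sub>R \<xi>) = r *\<^sub>R D \<xi>" for r
    using linear_scale[OF bounded_linear.linear[OF chart_derivative_linear[OF assms(2)]]] .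
  ultimately show ?thesis using assms by (simp add: velocity_def)
qed

lemma velocity_inverse: "velocity a \<xi> \<Longrightarrow> velocity (\<lambda>r. inv (a r)) (- \<xi>)"
  by (rule velocity_compose[OF _ chart_derivative_inverse_one]) simp_all

lemma velocity_conj: "velocity a \<xi> \<Longrightarrow> velocity (\<lambda>r. inv g \<otimes> a r \<otimes> g) (Ad G M g \<xi>)"
  by (rule velocity_compose[OF _ chart_derivative_Ad]) simp_all

lemma Ad_linear: "bounded_linear (Ad G M g)"
  using chart_derivative_linear[OF chart_derivative_Ad] .

text \<open>The left logarithmic derivative of \<phi> at t: the derivative translated back to the
  identity by \<open>inv (\<phi> t)\<close>.\<close>

definition left_velocity :: "(real \<Rightarrow> 'g) \<Rightarrow> real \<Rightarrow> 'v \<Rightarrow> bool" where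
  "left_velocity \<phi> t \<xi> \<longleftrightarrow> velocity (\<lambda>r. inv (\<phi> t) \<otimes> \<phi> (t + r)) \<xi>"

text \<open>With \<open>a r = inv (\<phi> t) \<otimes> \<phi> (t + r)\<close> and b likewise for
  \<psi>, the increment of the quotient is \<open>a r \<otimes> inv (b r)\<close> conjugated by
  \<open>inv (\<psi> t)\<close>. Its velocity is therefore \<open>Ad\<close> applied to \<xi> -
  \<xi>.\<close>

lemma left_velocity_quotient:
  assumes "left_velocity \<phi> t \<xi>" "left_velocity \<psi> t \<xi>"
  shows "left_velocity (\<lambda>t. \<phi> t \<otimes> inv (\<psi> t)) t 0"
proof -
  have "velocity (\<lambda>r. inv (inv (\<psi> t)) \<otimes> ((inv (\<phi> t) \<otimes> \<phi> (t + r)) \<otimes> inv (inv (\<psi> t) \<otimes> \<psi> (t + r))) \<otimes> inv (\<psi> t))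
      (Ad G M (inv (\<psi> t)) (\<xi> + - \<xi>))"
    using assms unfolding left_velocity_def
    by (intro velocity_conj velocity_mult velocity_inverse)
  then show ?thesis
    unfolding left_velocity_def
    by (simp add: m_assoc inv_mult_group linear_0[OF bounded_linear.linear[OF Ad_linear]])
qed

text \<open>Writing \<open>\<phi> s\<close> as
  \<open>\<phi> t \<otimes> (inv (\<phi> t) \<otimes> \<phi> s)\<close> and differentiating left
  translation by \<open>\<phi> t\<close> turns a left velocity into an ordinary differential
  equation in any atlas chart around \<open>\<phi> t\<close>.\<close>

lemma left_velocity_chart_derivative:
  assumes "left_velocity \<phi> t \<xi>" and d: "d \<in> atlas M" "\<phi> t \<in> cdom d"
  shows "chart_derivative (UNIV, id) d \<phi> t
     (\<lambda>r. r *\<^sub>R mult_derivative d identity_chart d (\<phi> t, \<one>) (0, \<xi>))"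
proof -
  let ?a = "\<lambda>r. inv (\<phi> t) \<otimes> \<phi> (t + r)"
  let ?D = "\<lambda>v. mult_derivative d identity_chart d (\<phi> t, \<one>) (0, v)"
  have D: "chart_derivative identity_chart d (\<lambda>h. \<phi> t \<otimes> h) \<one> ?D"
    using chart_derivative_left_mult[of d identity_chart d "\<phi> t" \<one>] d
    by (simp add: chart_at_in_atlas chart_at_covers)
  have a: "chart_derivative (UNIV, id) identity_chart ?a (t - t) (\<lambda>r. r *\<^sub>R \<xi>)" "?a 0 = \<one>"
    using assms(1) by (auto simp: left_velocity_def velocity_def)
  have s: "chart_derivative (UNIV, id) (UNIV, id) (\<lambda>s. s - t) t (\<lambda>r. r)"
    unfolding chart_derivative_identity_charts by (auto intro!: derivative_eq_intros)
  have "chart_derivative (UNIV, id) identity_chart (\<lambda>s. ?a (s - t)) t (\<lambda>r. r *\<^sub>R \<xi>)"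
    by (rule chart_derivative_compose[OF is_chart_identity is_chart_identity s a(1)])
  then have "chart_derivative (UNIV, id) d (\<lambda>s. \<phi> t \<otimes> ?a (s - t)) t (\<lambda>r. ?D (r *\<^sub>R \<xi>))"
    by (rule chart_derivative_compose[OF is_chart_identity chart_at_is_chart]) (use D a in simp)
  moreover have "?D (r *\<^sub>R \<xi>) = r *\<^sub>R ?D \<xi>" for r
    using linear_scale[OF bounded_linear.linear[OF chart_derivative_linear[OF D]]] .
  ultimately show ?thesis by simp
qed

lemma left_velocity_isCont: "left_velocity \<phi> t \<xi> \<Longrightarrow> isCont \<phi> t"
  using left_velocity_chart_derivative[of \<phi> t \<xi> "chart_at M (\<phi> t)"]
  by (simp add: chart_derivative_def chart_at_in_atlas chart_at_covers)

text \<open>Near each parameter the curve stays in one chart, where its coordinates have zero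
  derivative on an interval. Local constancy becomes global because I is connected.\<close>

lemma left_velocity_zero_imp_constant:
  assumes I: "open I" "connected I" and \<phi>: "\<And>t. t \<in> I \<Longrightarrow> left_velocity \<phi> t 0"
    and st: "s \<in> I" "t \<in> I"
  shows "\<phi> s = \<phi> t"
proof (rule connected_local_const[OF I(2) st], intro ballI)
  fix t assume t: "t \<in> I"
  let ?d = "chart_at M (\<phi> t)"
  have "eventually (\<lambda>s. \<phi> s \<in> cdom ?d) (at t)"
    by (rule isCont_eventually[OF left_velocity_isCont[OF \<phi>[OF t]] is_chartD(1)])
       (simp_all add: chart_at_covers)
  moreover have "eventually (\<lambda>s. s \<in> I) (at t)" using I(1) t eventually_at_in_open' by blast
  ultimately have "eventually (\<lambda>s. \<phi> s \<in> cdom ?d \<and> s \<in> I) (at t)" by eventually_elim simp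
  then obtain e where e: "e > 0" "\<And>s. s \<noteq> t \<Longrightarrow> dist s t < e \<Longrightarrow> \<phi> s \<in> cdom ?d \<and> s \<in> I"
    unfolding eventually_at by auto
  then have b: "\<phi> s \<in> cdom ?d" "s \<in> I" if "s \<in> ball t e" for s
    using that t chart_at_covers by (cases "s = t"; force simp: dist_commute)+
  have "((\<lambda>s. cmap ?d (\<phi> s)) has_derivative (\<lambda>r. 0)) (at s within ball t e)" if "s \<in> ball t e" for s
  proof -
    have cd: "chart_derivative (UNIV, id) ?d \<phi> s
       (\<lambda>r. r *\<^sub>R mult_derivative ?d identity_chart ?d (\<phi> s, \<one>) (0, 0))"
      by (rule left_velocity_chart_derivative) (use b[OF that] \<phi> in \<open>auto simp: chart_at_in_atlas\<close>)
    have "linear (mult_derivative ?d identity_chart ?d (\<phi> s, \<one>))"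
      using b[OF that]
      by (intro bounded_linear.linear[OF chart_derivative_linear[OF chart_derivative_mult]])
         (auto simp: chart_at_in_atlas chart_at_covers)
    from linear_0[OF this] have "mult_derivative ?d identity_chart ?d (\<phi> s, \<one>) (0, 0) = 0"
      by (simp add: zero_prod_def)
    with cd show ?thesis by (auto simp: chart_derivative_def intro: has_derivative_at_withinI)
  qed
  then obtain k where k: "\<And>s. s \<in> ball t e \<Longrightarrow> cmap ?d (\<phi> s) = k"
    using has_derivative_zero_constant[OF convex_ball] by metis
  have eq: "\<phi> t = \<phi> s" if "s \<in> ball t e" for s
  proof -
    have "cmap ?d (\<phi> s) = cmap ?d (\<phi> t)" using k[OF that] k[of t] e(1) by simp
    then show ?thesis using is_chartD(3)[OF chart_at_is_chart] b(1)[OF that] chart_at_covers by metis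
  qed
  have "eventually (\<lambda>s. s \<in> ball t e) (at t within I)"
    using e(1) by (auto simp: eventually_at dist_commute)
  then show "eventually (\<lambda>s. \<phi> t = \<phi> s) (at t within I)"
    by eventually_elim (rule eq)
qed

section \<open>One-parameter subgroups: uniqueness, existence and smoothness\<close>

text \<open>A one-parameter subgroup with smoothness weakened to differentiability at 0. Smoothness
  is recovered in \<open>hom_curve_smooth\<close>.\<close>

definition hom_curve :: "(real \<Rightarrow> 'g) \<Rightarrow> 'v \<Rightarrow> bool" where
  "hom_curve \<gamma> \<xi> \<longleftrightarrow> (\<forall>s t. \<gamma> (s + t) = \<gamma> s \<otimes> \<gamma> t) \<and> velocity \<gamma> \<xi>"

lemma hom_curve_left_velocity: "hom_curve \<gamma> \<xi> \<Longrightarrow> left_velocity \<gamma> t \<xi>"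
  by (simp add: hom_curve_def left_velocity_def)

lemma hom_curve_unique:
  assumes "hom_curve \<gamma> \<xi>" "hom_curve \<delta> \<xi>"
  shows "\<gamma> = \<delta>"
proof
  fix t
  have "\<gamma> t \<otimes> inv (\<delta> t) = \<gamma> 0 \<otimes> inv (\<delta> 0)"
    by (rule left_velocity_zero_imp_constant[of UNIV "\<lambda>t. \<gamma> t \<otimes> inv (\<delta> t)"])
       (simp_all add: left_velocity_quotient[OF hom_curve_left_velocity[OF assms(1)] hom_curve_left_velocity[OF assms(2)]])
  also have "\<dots> = \<one>" using assms by (simp add: hom_curve_def velocity_def)
  finally have "\<gamma> t \<otimes> inv (\<delta> t) \<otimes> \<delta> t = \<delta> t" by simp
  then show "\<gamma> t = \<delta> t" by (simp add: m_assoc)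
qed

text \<open>The left invariant vector field with value \<xi> at the identity, read in the chart d
  and written as a function of coordinates so that it can serve as the right-hand side of a
  differential equation.\<close>

definition left_field :: "('g, 'v) chart \<Rightarrow> 'v \<Rightarrow> 'v \<Rightarrow> 'v" where
  "left_field d \<xi> v =
     frechet_derivative (cmap d \<circ> mult \<circ> cinv (prod_chart d identity_chart))
       (at (v, cmap identity_chart \<one>)) (0, \<xi>)"

lemma left_field_eq: "left_field d \<xi> (cmap d x) = mult_derivative d identity_chart d (x, \<one>) (0, \<xi>)"
  by (simp add: left_field_def mult_derivative_def prod_chart_def)

lemma coordinates_exist_prod: "\<exists>(B :: ('v \<times> 'v) set) \<beta>. coordinates B \<beta>"
  using coordinates_exist coordinates_prod by blast

lemma smooth_on_left_field:
  assumes d: "d \<in> atlas M"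
  shows "smooth_on (cmap d ` cdom d) (left_field d \<xi>)"
proof -
  let ?p = "prod_chart d identity_chart"
  let ?m = "cmap d \<circ> mult \<circ> cinv ?p"
  let ?W = "cmap ?p ` (cdom ?p \<inter> mult -` cdom d)"
  obtain B :: "('v \<times> 'v) set" and \<beta> where co: "coordinates B \<beta>" using coordinates_exist_prod by blast
  have ch: "is_chart d" "is_chart ?p" using d by (simp_all add: atlas_is_chart is_chart_prod_chart)
  have W: "open ?W" by (rule smooth_map_open_domain[OF ch(2,1) continuous_mult])
  have "?p \<in> atlas (prod_manifold M M)" 
    using d chart_at_in_atlas by (simp add: prod_manifold_def del: split_paired_Ex) blast
  then have "smooth_on ?W ?m" using smooth_mult d by (auto simp: smooth_map_def)
  then have Z: "smooth_on ?W (\<lambda>p. frechet_derivative ?m (at p) (0, \<xi>))" by (rule smooth_on_derivative)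
  have im: "(\<lambda>v. (v, cmap identity_chart \<one>)) ` (cmap d ` cdom d) \<subseteq> ?W"
  proof (clarify)
    fix x assume "x \<in> cdom d"
    then have "(x, \<one>) \<in> cdom ?p \<inter> mult -` cdom d" by (simp add: prod_chart_def chart_at_covers)
    moreover have "(cmap d x, cmap identity_chart \<one>) = cmap ?p (x, \<one>)" by (simp add: prod_chart_def)
    ultimately show "(cmap d x, cmap identity_chart \<one>) \<in> ?W" by blast
  qed
  have "smooth_on (cmap d ` cdom d) (\<lambda>v. (v, cmap identity_chart \<one>))"
    using is_chartD(2)[OF ch(1)]
    by (intro smooth_on_Pair smooth_on_const smooth_on_bounded_linear bounded_linear_ident)
  from smooth_on_compose[OF co is_chartD(2)[OF ch(1)] W im Z this]
  show ?thesis unfolding left_field_def .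
qed

text \<open>An integral curve of the left invariant field in the identity chart. Smoothness of the
  field supplies the Lipschitz ball, which lies in the chart image, so \<open>cinv\<close> carries
  the solution to the group.\<close>

lemma local_left_velocity_curve_exists:
  obtains e \<gamma> where "e > 0" "\<gamma> 0 = \<one>" "\<And>t. \<bar>t\<bar> < e \<Longrightarrow> left_velocity \<gamma> t \<xi>"
proof -
  let ?c = identity_chart
  let ?u0 = "cmap ?c \<one>"
  let ?U = "cmap ?c ` cdom ?c"
  have c: "is_chart ?c" "?c \<in> atlas M" "\<one> \<in> cdom ?c" by (simp_all add: chart_at_in_atlas chart_at_covers)
  obtain B :: "'v set" and \<beta> where co: "coordinates B \<beta>" using coordinates_exist by blast
  obtain r L where rL: "r > 0" "cball ?u0 r \<subseteq> ?U" "L \<ge> 0"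
    "\<And>x y. x \<in> cball ?u0 r \<Longrightarrow> y \<in> cball ?u0 r \<Longrightarrow>
       norm (left_field ?c \<xi> x - left_field ?c \<xi> y) \<le> L * norm (x - y)"
    using smooth_on_locally_lipschitz[OF co is_chartD(2)[OF c(1)] smooth_on_left_field[OF c(2)], of ?u0] c(3)
    by blast
  obtain e u where e: "e > 0" and u: "u 0 = ?u0"
    "\<And>t. \<bar>t\<bar> < e \<Longrightarrow> u t \<in> cball ?u0 r"
    "\<And>t. \<bar>t\<bar> < e \<Longrightarrow> (u has_vector_derivative left_field ?c \<xi> (u t)) (at t)"
    using lipschitz_ode_local_solution[OF rL(1,3,4)] by metis
  define \<gamma> where "\<gamma> t = cinv ?c (u t)" for t
  have "left_velocity \<gamma> t \<xi>" if t: "\<bar>t\<bar> < e" for t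
  proof -
    have uU: "u s \<in> ?U" if "\<bar>s\<bar> < e" for s using u(2)[OF that] rL(2) by blast
    have g: "\<gamma> s \<in> cdom ?c" "cmap ?c (\<gamma> s) = u s" if "\<bar>s\<bar> < e" for s
      using is_chartD(4,5)[OF c(1) uU[OF that]] by (simp_all add: \<gamma>_def)
    have "isCont \<gamma> t"
      unfolding \<gamma>_def
      by (rule isCont_o2[OF has_vector_derivative_continuous[OF u(3)[OF t]]])
         (use is_chart_isCont(2)[OF c(1) g(1)[OF t]] g(2)[OF t] in simp)
    moreover have "((\<lambda>s. cmap ?c (\<gamma> s)) has_derivative (\<lambda>r. r *\<^sub>R left_field ?c \<xi> (u t))) (at t)"
      by (rule has_derivative_transform_within_open[where s = "{-e<..<e}",
            OF u(3)[OF t, unfolded has_vector_derivative_def]])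
         (use t g in \<open>auto simp: abs_less_iff\<close>)
    ultimately have cd: "chart_derivative (UNIV, id) ?c \<gamma> t (\<lambda>r. r *\<^sub>R left_field ?c \<xi> (u t))"
      using g(1)[OF t] by (simp add: chart_derivative_def)
    \<comment> \<open>Translating back by \<open>inv (\<gamma> t)\<close> undoes the translation by
      \<open>\<gamma> t\<close> that defines the field, so E sends the coordinate velocity of
      \<gamma> to \<xi>.\<close>
    obtain E where E: "chart_derivative ?c ?c (\<lambda>h. inv (\<gamma> t) \<otimes> h) (\<gamma> t) E"
      using chart_derivative_left_mult[of "chart_at M (inv (\<gamma> t))" ?c ?c "inv (\<gamma> t)" "\<gamma> t"] g(1)[OF t] c
      by (auto simp: chart_at_in_atlas chart_at_covers)
    have D: "chart_derivative ?c ?c (\<lambda>h. \<gamma> t \<otimes> h) \<one> (\<lambda>v. left_field ?c v (u t))"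
      using chart_derivative_left_mult[of ?c ?c ?c "\<gamma> t" \<one>] g[OF t] c left_field_eq[of ?c _ "\<gamma> t"] by simp
    have "chart_derivative ?c ?c (\<lambda>h. inv (\<gamma> t) \<otimes> (\<gamma> t \<otimes> h)) \<one> (\<lambda>v. E (left_field ?c v (u t)))"
      by (rule chart_derivative_compose[OF c(1,1) D]) (use E in simp)
    then have "(\<lambda>v. E (left_field ?c v (u t))) = (\<lambda>v. v)"
      using chart_derivative_unique[OF _ chart_derivative_id[OF c(1,3)]] by simp
    then have E1: "E (left_field ?c \<xi> (u t)) = \<xi>" by meson
    have lin: "E (r *\<^sub>R v) = r *\<^sub>R E v" for r v
      using linear_scale[OF bounded_linear.linear[OF chart_derivative_linear[OF E]]] .
    have sh: "chart_derivative (UNIV, id) (UNIV, id) (\<lambda>r. t + r) 0 (\<lambda>r. r)"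
      unfolding chart_derivative_identity_charts by (auto intro!: derivative_eq_intros)
    have "chart_derivative (UNIV, id) ?c (\<lambda>r. \<gamma> (t + r)) 0 (\<lambda>r. r *\<^sub>R left_field ?c \<xi> (u t))"
      by (rule chart_derivative_compose[OF is_chart_identity is_chart_identity sh]) (use cd in simp)
    then have "chart_derivative (UNIV, id) ?c (\<lambda>r. inv (\<gamma> t) \<otimes> \<gamma> (t + r)) 0
        (\<lambda>r. E (r *\<^sub>R left_field ?c \<xi> (u t)))"
      by (rule chart_derivative_compose[OF is_chart_identity c(1)]) (use E in simp)
    then show ?thesis by (simp add: left_velocity_def velocity_def lin E1)
  qed
  moreover have "\<gamma> 0 = \<one>" using u(1) is_chartD(3)[OF c(1,3)] by (simp add: \<gamma>_def)
  ultimately show thesis using that e by blast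
qed

text \<open>For fixed s, the curves \<open>\<lambda>t. \<gamma> (s + t)\<close> and \<gamma> have
  the same left velocity. Their quotient is thus constant, equal to its value
  \<open>\<gamma> s\<close> at t = 0.\<close>

lemma local_hom_curve_exists:
  obtains e \<gamma> where "e > 0" "velocity \<gamma> \<xi>"
    "\<And>s t. \<bar>s\<bar> < e \<Longrightarrow> \<bar>t\<bar> < e \<Longrightarrow> \<bar>s + t\<bar> < e \<Longrightarrow> \<gamma> (s + t) = \<gamma> s \<otimes> \<gamma> t"
proof -
  obtain e \<gamma> where e: "e > 0" and g0: "\<gamma> 0 = \<one>" and lv: "\<And>t. \<bar>t\<bar> < e \<Longrightarrow> left_velocity \<gamma> t \<xi>"
    using local_left_velocity_curve_exists by blast
  show thesis
  proof
    show "e > 0" by fact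
    show "velocity \<gamma> \<xi>" using lv[of 0] e g0 by (simp add: left_velocity_def)
    fix s t :: real assume st: "\<bar>s\<bar> < e" "\<bar>t\<bar> < e" "\<bar>s + t\<bar> < e"
    \<comment> \<open>The parameters x for which both x and s + x lie in the domain (-e, e); it
      contains 0 and t.\<close>
    let ?I = "{max (-e) (-e - s)<..<min e (e - s)}"
    have "\<gamma> (s + t) \<otimes> inv (\<gamma> t) = \<gamma> (s + 0) \<otimes> inv (\<gamma> 0)"
    proof (rule left_velocity_zero_imp_constant[of ?I "\<lambda>t. \<gamma> (s + t) \<otimes> inv (\<gamma> t)"])
      fix x assume x: "x \<in> ?I"
      have "left_velocity (\<lambda>t. \<gamma> (s + t)) x \<xi>"
        using lv[of "s + x"] x by (auto simp: left_velocity_def add.assoc abs_less_iff)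
      then show "left_velocity (\<lambda>t. \<gamma> (s + t) \<otimes> inv (\<gamma> t)) x 0"
        by (rule left_velocity_quotient) (use x in \<open>auto intro!: lv simp: abs_less_iff\<close>)
    qed (use st e in \<open>auto simp: abs_less_iff\<close>)
    then have "\<gamma> (s + t) \<otimes> inv (\<gamma> t) \<otimes> \<gamma> t = \<gamma> s \<otimes> \<gamma> t" using g0 by simp
    then show "\<gamma> (s + t) = \<gamma> s \<otimes> \<gamma> t" by (simp add: m_assoc)
  qed
qed

text \<open>The local curve extends to the real line by \<open>t \<mapsto> \<gamma> (t / N) ^ N\<close> for large \<open>N\<close>.\<close>

lemma hom_curve_exists: "\<exists>\<gamma>. hom_curve \<gamma> \<xi>"
proof -
  obtain e \<gamma> where e: "e > 0" and vel: "velocity \<gamma> \<xi>"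
    and hom: "\<And>s t. \<bar>s\<bar> < e \<Longrightarrow> \<bar>t\<bar> < e \<Longrightarrow> \<bar>s + t\<bar> < e \<Longrightarrow> \<gamma> (s + t) = \<gamma> s \<otimes> \<gamma> t"
    using local_hom_curve_exists by blast
  have g0: "\<gamma> 0 = \<one>" using vel by (simp add: velocity_def)
  have pow: "\<gamma> (real k * x) = \<gamma> x [^] k" if "\<bar>real k * x\<bar> < e" for k x
    using that
  proof (induction k)
    case (Suc k)
    have le: "\<bar>real k * x\<bar> \<le> \<bar>real (Suc k) * x\<bar>" "\<bar>x\<bar> \<le> \<bar>real (Suc k) * x\<bar>"
      unfolding abs_mult by (simp_all add: mult_right_mono mult_le_cancel_right1 algebra_simps)
    have "\<gamma> (real k * x + x) = \<gamma> (real k * x) \<otimes> \<gamma> x"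
      by (rule hom) (use le Suc.prems in \<open>simp_all add: algebra_simps\<close>)
    also have "\<dots> = \<gamma> x [^] Suc k" using Suc.IH le Suc.prems by simp
    finally show ?case by (simp add: algebra_simps)
  qed (simp add: g0)
  define P where "P N t = \<gamma> (t / real N) [^] N" for N :: nat and t
  \<comment> \<open>N is so large that t / N lies in the interval where the local group law
    holds.\<close>
  define good where "good N t \<longleftrightarrow> N > 0 \<and> \<bar>t\<bar> < real N * e" for N :: nat and t
  have refine: "P (N * K) t = P N t" if "good N t" "K > 0" for N K t
  proof -
    have N: "N > 0" "\<bar>t / real N\<bar> < e" using that by (auto simp: good_def field_simps abs_mult)
    have eq: "real K * (t / real (N * K)) = t / real N" using that N by simp
    have "\<gamma> (t / real N) = \<gamma> (t / real (N * K)) [^] K" using pow[of K "t / real (N * K)"] N(2) unfolding eq by simp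
    then show ?thesis by (simp add: P_def nat_pow_pow mult.commute)
  qed
  \<comment> \<open>Both sides equal the value at the common refinement N * K.\<close>
  have indep: "P N t = P K t" if "good N t" "good K t" for N K t
    using refine[OF that(1), of K] refine[OF that(2), of N] that by (simp add: good_def mult.commute)
  have mono: "good K t" if "good N t" "N \<le> K" for N K t
  proof -
    have "real N * e \<le> real K * e" using that e by (intro mult_right_mono) auto
    then show ?thesis using that by (auto simp: good_def)
  qed
  \<comment> \<open>The successor makes n positive and the inequality required by
    \<open>good\<close> strict.\<close>
  define n where "n t = Suc (nat \<lceil>\<bar>t\<bar> / e\<rceil>)" for t
  have n: "good (n t) t" for t
  proof -
    have "\<bar>t\<bar> / e \<le> real (nat \<lceil>\<bar>t\<bar> / e\<rceil>)" by (rule real_nat_ceiling_ge)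
    then have "\<bar>t\<bar> / e < real (n t)" by (simp add: n_def)
    then show ?thesis using e by (simp add: good_def n_def field_simps)
  qed
  define \<Gamma> where "\<Gamma> t = P (n t) t" for t
  have \<Gamma>: "\<Gamma> t = P N t" if "good N t" for N t using indep[OF n that] by (simp add: \<Gamma>_def)
  have "\<Gamma> (s + t) = \<Gamma> s \<otimes> \<Gamma> t" for s t
  proof -
    define N where "N = n s + n t + n (s + t)"
    have N: "good N s" "good N t" "good N (s + t)" using mono[OF n] by (simp_all add: N_def)
    have lt: "\<bar>s / real N\<bar> < e" "\<bar>t / real N\<bar> < e" "\<bar>s / real N + t / real N\<bar> < e"
      using N by (auto simp: good_def field_simps abs_mult add_divide_distrib[symmetric])
    have "\<gamma> (s / real N + t / real N) = \<gamma> (s / real N) \<otimes> \<gamma> (t / real N)" by (rule hom[OF lt])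
    \<comment> \<open>G may be non-abelian, and the power of a product splits only for commuting
      factors. These commute since s + t = t + s.\<close>
    moreover have "\<gamma> (s / real N) \<otimes> \<gamma> (t / real N) = \<gamma> (t / real N) \<otimes> \<gamma> (s / real N)"
      using hom[OF lt(1,2,3)] hom[OF lt(2,1)] lt(3) by (simp add: add.commute)
    ultimately have "P N (s + t) = P N s \<otimes> P N t"
      using pow_mult_distrib[of "\<gamma> (s / real N)" "\<gamma> (t / real N)" N]
      by (simp add: P_def add_divide_distrib)
    then show ?thesis using \<Gamma> N by simp
  qed
  moreover have "velocity \<Gamma> \<xi>"
  proof -
    have "eventually (\<lambda>t. t \<in> {-e<..<e}) (nhds (0::real))" using e by (intro eventually_nhds_in_open) auto
    then have ev: "eventually (\<lambda>t. \<gamma> t = \<Gamma> t) (nhds 0)"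
    proof eventually_elim
      case (elim t)
      then have "good 1 t" by (auto simp: good_def abs_less_iff)
      from \<Gamma>[OF this] show ?case by (simp add: P_def)
    qed
    show ?thesis
      using chart_derivative_transform[OF is_chart_identity _ ev] vel eventually_nhds_x_imp_x[OF ev]
      unfolding velocity_def by metis
  qed
  ultimately show ?thesis by (auto simp: hom_curve_def)
qed

lemma hom_curve_chart_derivative:
  assumes "hom_curve \<gamma> \<xi>" "d \<in> atlas M" "\<gamma> t \<in> cdom d"
  shows "chart_derivative (UNIV, id) d \<gamma> t (\<lambda>r. r *\<^sub>R left_field d \<xi> (cmap d (\<gamma> t)))"
  using left_velocity_chart_derivative[OF hom_curve_left_velocity[OF assms(1)] assms(2,3)]
  by (simp add: left_field_eq)

text \<open>Bootstrapping: in a chart the derivative of \<gamma> is the smooth field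
  \<open>left_field\<close> evaluated along \<gamma>, so class k implies class k + 1.\<close>

lemma hom_curve_smooth:
  assumes \<gamma>: "hom_curve \<gamma> \<xi>"
  shows "smooth_map vector_manifold M \<gamma>"
proof -
  have cont: "continuous_on UNIV \<gamma>"
    using left_velocity_isCont[OF hom_curve_left_velocity[OF \<gamma>]]
    by (simp add: continuous_at_imp_continuous_on)
  have "Ck_on k (\<gamma> -` cdom d) (\<lambda>t. cmap d (\<gamma> t))" if d: "d \<in> atlas M" for d k
  proof -
    have op: "open (\<gamma> -` cdom d)" by (rule open_vimage[OF open_chart_domain[OF d] cont])
    obtain B :: "'v set" and \<beta> where co: "coordinates B \<beta>" using coordinates_exist by blast
    show ?thesis
    proof (induction k)
      case 0
      have "continuous_on (\<gamma> -` cdom d) (\<lambda>t. cmap d (\<gamma> t))"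
        by (rule continuous_on_compose2[OF is_chartD(6)[OF atlas_is_chart[OF d]] continuous_on_subset[OF cont]]) auto
      then show ?case by simp
    next
      case (Suc k)
      have "Ck_on k (\<gamma> -` cdom d) (\<lambda>t. left_field d \<xi> (cmap d (\<gamma> t)))"
        by (rule Ck_on_compose[OF co op open_chart_image[OF d] _ smooth_onD[OF smooth_on_left_field[OF d]] Suc]) auto
      then have "Ck_on k (\<gamma> -` cdom d) (\<lambda>t. v *\<^sub>R left_field d \<xi> (cmap d (\<gamma> t)))" for v
        by (rule Ck_on_bounded_linear_compose[OF op bounded_linear_scaleR_right])
      moreover have "((\<lambda>t. cmap d (\<gamma> t)) has_derivative (\<lambda>r. r *\<^sub>R left_field d \<xi> (cmap d (\<gamma> t)))) (at t)"
        if "t \<in> \<gamma> -` cdom d" for t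
        using hom_curve_chart_derivative[OF \<gamma> d, of t] that by (simp add: chart_derivative_def)
      ultimately show ?case by (rule_tac Ck_on_SucI[OF op])
    qed
  qed
  then show ?thesis using cont by (simp add: smooth_map_def vector_manifold_def smooth_on_def comp_def)
qed

text \<open>The condition under \<open>THE\<close> in \<open>lie_exp\<close> becomes
  \<open>hom_curve\<close>, for which existence and uniqueness are proved.\<close>

lemma one_parameter_subgroup_iff_hom_curve:
  "one_parameter_subgroup G M \<gamma> \<and> tangent_map vector_manifold M \<gamma> 0 1 = \<xi> \<longleftrightarrow> hom_curve \<gamma> \<xi>"
  (is "?L \<longleftrightarrow> ?R")
proof
  assume L: ?L
  then have hom: "\<gamma> (s + t) = \<gamma> s \<otimes> \<gamma> t" for s t by (simp add: one_parameter_subgroup_def)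
  \<comment> \<open>\<open>\<gamma> 0\<close> is idempotent, hence the identity.\<close>
  have "inv (\<gamma> 0) \<otimes> \<gamma> 0 = inv (\<gamma> 0) \<otimes> (\<gamma> 0 \<otimes> \<gamma> 0)" using hom[of 0 0] by simp
  then have g0: "\<gamma> 0 = \<one>" by simp
  let ?D = "frechet_derivative (cmap identity_chart \<circ> \<gamma> \<circ> cinv (UNIV, id)) (at (cmap (UNIV, id) 0))"
  have D: "chart_derivative (UNIV, id) identity_chart \<gamma> 0 ?D"
    by (rule smooth_map_chart_derivative[of vector_manifold M])
       (use L g0 in \<open>simp_all add: one_parameter_subgroup_def vector_manifold_def chart_at_in_atlas chart_at_covers\<close>)
  have "?D = (\<lambda>r. r *\<^sub>R \<xi>)"
  proof
    fix r
    have "?D (r *\<^sub>R 1) = r *\<^sub>R ?D 1"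
      by (rule linear_scale[OF bounded_linear.linear[OF chart_derivative_linear[OF D]]])
    moreover have "?D 1 = \<xi>" using L g0 by (simp add: tangent_map_def vector_manifold_def)
    ultimately show "?D r = r *\<^sub>R \<xi>" by simp
  qed
  with D g0 hom show ?R by (simp add: hom_curve_def velocity_def)
next
  assume R: ?R
  then have g0: "\<gamma> 0 = \<one>" and D: "chart_derivative (UNIV, id) identity_chart \<gamma> 0 (\<lambda>r. r *\<^sub>R \<xi>)"
    by (simp_all add: hom_curve_def velocity_def)
  have "tangent_map vector_manifold M \<gamma> 0 1 = \<xi>"
    using chart_derivative_frechet[OF D] g0 by (simp add: tangent_map_def vector_manifold_def)
  then show ?L using R hom_curve_smooth[OF R] by (simp add: one_parameter_subgroup_def hom_curve_def)
qed

lemma lie_exp_hom_curve: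
  assumes "hom_curve \<gamma> \<xi>"
  shows "lie_exp G M \<xi> = \<gamma> 1"
proof -
  have "(THE \<gamma>. hom_curve \<gamma> \<xi>) = \<gamma>" using assms hom_curve_unique by blast
  then show ?thesis unfolding lie_exp_def one_parameter_subgroup_iff_hom_curve by simp
qed

text \<open>The reparametrized curve \<open>\<lambda>s. \<gamma> (t * s)\<close> is the subgroup
  with velocity \<open>t *\<^sub>R \<xi>\<close>; evaluate it at 1.\<close>

lemma lie_exp_scaleR_hom_curve:
  assumes "hom_curve \<gamma> \<xi>"
  shows "lie_exp G M (t *\<^sub>R \<xi>) = \<gamma> t"
proof -
  have sc: "chart_derivative (UNIV, id) (UNIV, id) (\<lambda>s. t * s) 0 (\<lambda>s. t * s)"
    unfolding chart_derivative_identity_charts by (auto intro!: derivative_eq_intros)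
  have "chart_derivative (UNIV, id) identity_chart (\<lambda>s. \<gamma> (t * s)) 0 (\<lambda>s. (t * s) *\<^sub>R \<xi>)"
    by (rule chart_derivative_compose[OF is_chart_identity is_chart_identity sc])
       (use assms in \<open>simp add: hom_curve_def velocity_def\<close>)
  then have "hom_curve (\<lambda>s. \<gamma> (t * s)) (t *\<^sub>R \<xi>)"
    using assms by (simp add: hom_curve_def velocity_def distrib_left mult.commute)
  from lie_exp_hom_curve[OF this] show ?thesis by simp
qed

section \<open>The Lie bracket\<close>

abbreviation conj_coordinates :: "'v \<times> 'v \<Rightarrow> 'v" where
  "conj_coordinates \<equiv> \<lambda>z. cmap identity_chart
     (inv (cinv identity_chart (fst z)) \<otimes> cinv identity_chart (snd z) \<otimes> cinv identity_chart (fst z))"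

text \<open>Near the pair of identities the coordinate expression is a composite of the coordinate
  forms of multiplication and inversion, with bracketing
  \<open>inv x \<otimes> (h \<otimes> x)\<close>.\<close>

lemma smooth_on_conj_coordinates:
  obtains W where "open W" "(cmap identity_chart \<one>, cmap identity_chart \<one>) \<in> W"
    "smooth_on W conj_coordinates"
proof -
  let ?c = identity_chart
  let ?p = "prod_chart ?c ?c"
  let ?m = "cmap ?c \<circ> mult \<circ> cinv ?p" and ?i = "cmap ?c \<circ> (\<lambda>x. inv x) \<circ> cinv ?c"
  let ?Wm = "cmap ?p ` (cdom ?p \<inter> mult -` cdom ?c)"
  let ?Wi = "cmap ?c ` (cdom ?c \<inter> (\<lambda>x. inv x) -` cdom ?c)"
  obtain B :: "('v \<times> 'v) set" and \<beta> where co2: "coordinates B \<beta>" using coordinates_exist_prod by blast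
  obtain B1 :: "'v set" and \<beta>1 where co1: "coordinates B1 \<beta>1" using coordinates_exist by blast
  have c: "is_chart ?c" "?c \<in> atlas M" "\<one> \<in> cdom ?c" by (simp_all add: chart_at_in_atlas chart_at_covers)
  have p: "is_chart ?p" "?p \<in> atlas (prod_manifold M M)"
    using c by (simp_all add: is_chart_prod_chart prod_manifold_def del: split_paired_Ex) blast
  have contI: "continuous_on UNIV (\<lambda>x. inv x)" using smooth_inverse by (simp add: smooth_map_def)
  have Wm: "open ?Wm" and Wi: "open ?Wi"
    by (rule smooth_map_open_domain[OF p(1) c(1) continuous_mult])
       (rule smooth_map_open_domain[OF c(1) c(1) contI])
  have m: "smooth_on ?Wm ?m" and i: "smooth_on ?Wi ?i"
    using smooth_mult smooth_inverse c p unfolding smooth_map_def by blast+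
  let ?sw = "\<lambda>z. (snd z, fst z)"
  \<comment> \<open>The conditions that \<open>h \<otimes> x\<close>, \<open>inv x\<close> and the
    final product all stay in the identity chart, so that this one chart reads every intermediate
    result.\<close>
  define T where "T = (cdom ?p \<inter> (\<lambda>z. mult (snd z, fst z)) -` cdom ?c) \<inter> ((\<lambda>z. inv (fst z)) -` cdom ?c \<inter>
     (\<lambda>z. mult (inv (fst z), mult (snd z, fst z))) -` cdom ?c)"
  have cont1: "continuous_on UNIV (\<lambda>z. mult (snd z, fst z))"
    by (rule continuous_on_compose2[OF continuous_mult]) (auto intro!: continuous_intros)
  have cont2: "continuous_on UNIV (\<lambda>z::'g \<times> 'g. inv (fst z))"
    by (rule continuous_on_compose2[OF contI]) (auto intro!: continuous_intros)
  have cont3: "continuous_on UNIV (\<lambda>z. mult (inv (fst z), mult (snd z, fst z)))"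
    by (rule continuous_on_compose2[OF continuous_mult continuous_on_Pair[OF cont2 cont1]]) auto
  have "open T" unfolding T_def
    by (intro open_Int open_vimage is_chartD(1)[OF p(1)] is_chartD(1)[OF c(1)] cont1 cont2 cont3)
  define W where "W = cmap ?p ` (cdom ?p \<inter> T)"
  have W: "open W" unfolding W_def by (rule open_chart_image_Int[OF p(1) \<open>open T\<close>])
  have WE: "\<exists>x h. x \<in> cdom ?c \<and> h \<in> cdom ?c \<and> z = (cmap ?c x, cmap ?c h) \<and> inv x \<in> cdom ?c \<and>
      h \<otimes> x \<in> cdom ?c \<and> inv x \<otimes> (h \<otimes> x) \<in> cdom ?c" if "z \<in> W" for z
  proof -
    obtain q where "q \<in> cdom ?p \<inter> T" "z = cmap ?p q" using \<open>z \<in> W\<close> unfolding W_def by blast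
    then show ?thesis by (intro exI[of _ "fst q"] exI[of _ "snd q"]) (auto simp: T_def prod_chart_def)
  qed
  have mI: "(cmap ?c x, cmap ?c y) \<in> ?Wm" if "x \<in> cdom ?c" "y \<in> cdom ?c" "x \<otimes> y \<in> cdom ?c" for x y
  proof -
    have "(x, y) \<in> cdom ?p \<inter> mult -` cdom ?c" using that by (simp add: prod_chart_def)
    moreover have "(cmap ?c x, cmap ?c y) = cmap ?p (x, y)" by (simp add: prod_chart_def)
    ultimately show ?thesis by blast
  qed
  have mv: "?m (cmap ?c x, cmap ?c y) = cmap ?c (x \<otimes> y)" if "x \<in> cdom ?c" "y \<in> cdom ?c" for x y
    using that by (simp add: cinv_prod_chart[OF c(1) c(1)] is_chartD(3)[OF c(1)])
  have iv: "?i (cmap ?c x) = cmap ?c (inv x)" if "x \<in> cdom ?c" for x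
    using that by (simp add: is_chartD(3)[OF c(1)])
  have sm1: "smooth_on W (\<lambda>z. ?m (snd z, fst z))"
  proof (rule smooth_on_compose[OF co2 W Wm _ m])
    show "?sw ` W \<subseteq> ?Wm" using WE mI by fastforce
    show "smooth_on W ?sw"
      by (intro smooth_on_Pair W smooth_on_bounded_linear bounded_linear_fst bounded_linear_snd)
  qed
  have sm2: "smooth_on W (\<lambda>z. ?i (fst z))"
  proof (rule smooth_on_compose[OF co1 W Wi _ i])
    show "fst ` W \<subseteq> ?Wi" using WE by fastforce
    show "smooth_on W fst" by (intro W smooth_on_bounded_linear bounded_linear_fst)
  qed
  have sm3: "smooth_on W (\<lambda>z. ?m (?i (fst z), ?m (snd z, fst z)))"
  proof (rule smooth_on_compose[OF co2 W Wm _ m])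
    show "(\<lambda>z. (?i (fst z), ?m (snd z, fst z))) ` W \<subseteq> ?Wm"
    proof (rule image_subsetI)
      fix z assume "z \<in> W"
      from WE[OF this] obtain x h where z: "x \<in> cdom ?c" "h \<in> cdom ?c" "z = (cmap ?c x, cmap ?c h)"
        "inv x \<in> cdom ?c" "h \<otimes> x \<in> cdom ?c" "inv x \<otimes> (h \<otimes> x) \<in> cdom ?c" by blast
      then show "(?i (fst z), ?m (snd z, fst z)) \<in> ?Wm"
        using mI[of "inv x" "h \<otimes> x"] mv[of h x] iv[of x] by simp
    qed
    show "smooth_on W (\<lambda>z. (?i (fst z), ?m (snd z, fst z)))" by (rule smooth_on_Pair[OF W sm2 sm1])
  qed
  have eq: "?m (?i (fst z), ?m (snd z, fst z)) = conj_coordinates z" if "z \<in> W" for z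
  proof -
    from WE[OF that] obtain x h where z: "x \<in> cdom ?c" "h \<in> cdom ?c" "z = (cmap ?c x, cmap ?c h)"
        "inv x \<in> cdom ?c" "h \<otimes> x \<in> cdom ?c" "inv x \<otimes> (h \<otimes> x) \<in> cdom ?c" by blast
    have "?m (?i (fst z), ?m (snd z, fst z)) = cmap ?c (inv x \<otimes> (h \<otimes> x))"
      unfolding z(3) fst_conv snd_conv mv[OF z(2,1)] iv[OF z(1)] mv[OF z(4,5)] ..
    then show ?thesis using z(1,2) by (simp add: z(3) is_chartD(3)[OF c(1)] m_assoc)
  qed
  have "smooth_on W conj_coordinates"
    unfolding smooth_on_def by (intro allI) (rule Ck_on_cong[OF W eq smooth_onD[OF sm3]])
  moreover have "(cmap ?c \<one>, cmap ?c \<one>) \<in> W"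
  proof -
    have "(\<one>, \<one>) \<in> cdom ?p \<inter> T" using c(3) by (simp add: T_def prod_chart_def)
    moreover have "(cmap ?c \<one>, cmap ?c \<one>) = cmap ?p (\<one>, \<one>)" by (simp add: prod_chart_def)
    ultimately show ?thesis unfolding W_def by blast
  qed
  ultimately show thesis using that W by blast
qed

text \<open>\<open>Ad\<close> applied to \<eta> is the partial derivative of
  \<open>conj_coordinates\<close> in its second variable at the identity. As a directional
  derivative of a smooth map it is again differentiable in the first variable.\<close>

lemma Ad_coordinates_differentiable:
  "\<exists>L. ((\<lambda>x. Ad G M (cinv identity_chart x) \<eta>) has_derivative L) (at (cmap identity_chart \<one>))"
proof -
  let ?c = identity_chart
  let ?u0 = "cmap ?c \<one>"
  let ?D = "\<lambda>x. frechet_derivative conj_coordinates (at (x, ?u0))"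
  obtain W where W: "open W" "(?u0, ?u0) \<in> W" "smooth_on W conj_coordinates"
    using smooth_on_conj_coordinates by blast
  define U where "U = (\<lambda>x. (x, ?u0)) -` W"
  have U: "open U" unfolding U_def by (intro open_vimage W(1) continuous_intros)
  have Ad: "Ad G M (cinv ?c x) \<eta> = ?D x (0, \<eta>)" if "x \<in> U" for x
  proof -
    have "(conj_coordinates has_derivative ?D x) (at (x, ?u0))"
      by (rule smooth_on_has_derivative[OF W(3)]) (use that U_def in simp)
    then have A1: "((\<lambda>h. conj_coordinates (x, h)) has_derivative (\<lambda>v. ?D x (0, v))) (at ?u0)"
      by (intro has_derivative_compose[where g = conj_coordinates and f = "\<lambda>h. (x, h)" and f' = "\<lambda>v. (0, v)"]) 
         (auto intro!: derivative_eq_intros)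
    have A2: "((\<lambda>h. conj_coordinates (x, h)) has_derivative Ad G M (cinv ?c x)) (at ?u0)"
      using chart_derivative_Ad[of "cinv ?c x"] by (simp add: chart_derivative_def)
    show ?thesis by (rule fun_cong[OF has_derivative_unique[OF A2 A1]])
  qed
  have "smooth_on W (\<lambda>z. frechet_derivative conj_coordinates (at z) (0, \<eta>))"
    by (rule smooth_on_derivative[OF W(3)])
  from smooth_on_has_derivative[OF this W(2)] obtain L where
    "((\<lambda>z. frechet_derivative conj_coordinates (at z) (0, \<eta>)) has_derivative L) (at (?u0, ?u0))" by blast
  then have "((\<lambda>x. ?D x (0, \<eta>)) has_derivative (\<lambda>v. L (v, 0))) (at ?u0)"
    by (intro has_derivative_compose[where f = "\<lambda>x. (x, ?u0)" and f' = "\<lambda>v. (v, 0)"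
          and g = "\<lambda>z. frechet_derivative conj_coordinates (at z) (0, \<eta>)"])
       (auto intro!: derivative_eq_intros)
  then have "((\<lambda>x. Ad G M (cinv ?c x) \<eta>) has_derivative (\<lambda>v. L (v, 0))) (at ?u0)"
    by (rule has_derivative_transform_within_open[OF _ U]) (use W(2) Ad U_def in auto)
  then show ?thesis by blast
qed

text \<open>One map L serves all \<xi> at once: it is the derivative of \<open>Ad\<close> in
  coordinates at the identity, composed with curves of velocity \<xi>. This is the source of
  linearity of the bracket in its first argument.\<close>

lemma Ad_lie_exp_has_vector_derivative:
  "\<exists>L. bounded_linear L \<and>
     (\<forall>\<xi>. ((\<lambda>t::real. Ad G M (lie_exp G M (t *\<^sub>R \<xi>)) \<eta>) has_vector_derivative L \<xi>) (at 0))"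
proof -
  let ?c = identity_chart
  let ?A = "\<lambda>x. Ad G M (cinv ?c x) \<eta>"
  have c: "is_chart ?c" "\<one> \<in> cdom ?c" by (simp_all add: chart_at_covers)
  obtain L where L: "(?A has_derivative L) (at (cmap ?c \<one>))" using Ad_coordinates_differentiable by blast
  have "((\<lambda>t::real. Ad G M (lie_exp G M (t *\<^sub>R \<xi>)) \<eta>) has_vector_derivative L \<xi>) (at 0)" for \<xi>
  proof -
    obtain \<gamma> where \<gamma>: "hom_curve \<gamma> \<xi>" using hom_curve_exists by blast
    then have g0: "\<gamma> 0 = \<one>" and cd: "chart_derivative (UNIV, id) ?c \<gamma> 0 (\<lambda>r. r *\<^sub>R \<xi>)"
      by (simp_all add: hom_curve_def velocity_def)
    have d: "((\<lambda>t. cmap ?c (\<gamma> t)) has_derivative (\<lambda>r. r *\<^sub>R \<xi>)) (at 0)"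
      using cd by (simp add: chart_derivative_def)
    have "((\<lambda>t. ?A (cmap ?c (\<gamma> t))) has_derivative (\<lambda>r. L (r *\<^sub>R \<xi>))) (at 0)"
      by (rule has_derivative_compose[OF d]) (use L g0 in simp)
    moreover have "eventually (\<lambda>t. ?A (cmap ?c (\<gamma> t)) = Ad G M (lie_exp G M (t *\<^sub>R \<xi>)) \<eta>) (at 0)"
    proof -
      have "eventually (\<lambda>t. \<gamma> t \<in> cdom ?c) (at 0)"
        by (rule isCont_eventually[OF left_velocity_isCont[OF hom_curve_left_velocity[OF \<gamma>]] is_chartD(1)[OF c(1)]])
           (simp add: g0 c)
      then show ?thesis
        by eventually_elim (simp add: is_chartD(3)[OF c(1)] lie_exp_scaleR_hom_curve[OF \<gamma>])
    qed
    ultimately have "((\<lambda>t. Ad G M (lie_exp G M (t *\<^sub>R \<xi>)) \<eta>) has_derivative (\<lambda>r. L (r *\<^sub>R \<xi>))) (at 0)"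
      by (rule has_derivative_transform_eventually)
         (use lie_exp_scaleR_hom_curve[OF \<gamma>, of 0] in \<open>simp_all add: g0 is_chartD(3)[OF c]\<close>)
    then show ?thesis
      by (simp add: has_vector_derivative_def linear_scale[OF has_derivative_linear[OF L]])
  qed
  then show ?thesis using has_derivative_bounded_linear[OF L] by blast
qed

lemma lie_bracket_has_vector_derivative:
  "((\<lambda>t::real. Ad G M (lie_exp G M (t *\<^sub>R \<xi>)) \<eta>) has_vector_derivative lie_bracket G M \<xi> \<eta>) (at 0)"
  unfolding lie_bracket_def using Ad_lie_exp_has_vector_derivative[of \<eta>] vector_derivative_at by metis

lemma lie_bracket_bounded_linear_left: "bounded_linear (\<lambda>\<xi>. lie_bracket G M \<xi> \<eta>)"
proof -
  obtain L where "bounded_linear L"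
    "\<And>\<xi>. ((\<lambda>t::real. Ad G M (lie_exp G M (t *\<^sub>R \<xi>)) \<eta>) has_vector_derivative L \<xi>) (at 0)"
    using Ad_lie_exp_has_vector_derivative by blast
  moreover from this(2) have "(\<lambda>\<xi>. lie_bracket G M \<xi> \<eta>) = L"
    unfolding lie_bracket_def using vector_derivative_at by blast
  ultimately show ?thesis by simp
qed

text \<open>Each \<open>Ad G M g\<close> is linear, and linearity survives differentiation in t;
  boundedness comes from finite dimension.\<close>

lemma lie_bracket_bounded_linear_right: "bounded_linear (lie_bracket G M \<xi>)"
proof -
  obtain B :: "'v set" and \<beta> where co: "coordinates B \<beta>" using coordinates_exist by blast
  have Ad: "linear (Ad G M g)" for g using Ad_linear bounded_linear.linear by blast
  have "lie_bracket G M \<xi> (\<eta> + \<zeta>) = lie_bracket G M \<xi> \<eta> + lie_bracket G M \<xi> \<zeta>" for \<eta> \<zeta>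
    using has_vector_derivative_add[OF lie_bracket_has_vector_derivative[of \<xi> \<eta>] lie_bracket_has_vector_derivative[of \<xi> \<zeta>]]
      lie_bracket_has_vector_derivative[of \<xi> "\<eta> + \<zeta>"] vector_derivative_unique_at
    unfolding linear_add[OF Ad] by blast
  moreover have "lie_bracket G M \<xi> (r *\<^sub>R \<eta>) = r *\<^sub>R lie_bracket G M \<xi> \<eta>" for r \<eta>
    using bounded_linear.has_vector_derivative[OF bounded_linear_scaleR_right[of r] lie_bracket_has_vector_derivative[of \<xi> \<eta>]]
      lie_bracket_has_vector_derivative[of \<xi> "r *\<^sub>R \<eta>"] vector_derivative_unique_at
    unfolding linear_scale[OF Ad] by blast
  ultimately show ?thesis
    by (intro coordinates_linear_imp_bounded_linear[OF co] linearI)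
qed

text \<open>\<open>exp (t \<xi>)\<close> commutes with \<open>exp (s \<xi>)\<close>, so \<open>Ad\<close> of the former fixes \<open>\<xi>\<close>.\<close>

lemma lie_bracket_self: "lie_bracket G M \<xi> \<xi> = 0"
proof -
  obtain \<gamma> where \<gamma>: "hom_curve \<gamma> \<xi>" using hom_curve_exists by blast
  then have hom: "\<gamma> (s + t) = \<gamma> s \<otimes> \<gamma> t" for s t by (simp add: hom_curve_def)
  have vel: "velocity \<gamma> \<xi>" using \<gamma> by (simp add: hom_curve_def)
  have "Ad G M (\<gamma> t) \<xi> = \<xi>" for t
  proof -
    have "inv (\<gamma> t) \<otimes> \<gamma> r \<otimes> \<gamma> t = \<gamma> r" for r
      using hom[of r t] hom[of t r] by (simp add: m_assoc add.commute)
    then have "velocity \<gamma> (Ad G M (\<gamma> t) \<xi>)" using velocity_conj[OF vel, of "\<gamma> t"] by simp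
    then show ?thesis using vel velocity_unique by blast
  qed
  then have "((\<lambda>t::real. \<xi>) has_vector_derivative lie_bracket G M \<xi> \<xi>) (at 0)"
    using lie_bracket_has_vector_derivative[of \<xi> \<xi>] by (simp add: lie_exp_scaleR_hom_curve[OF \<gamma>])
  then show ?thesis using vector_derivative_unique_at has_vector_derivative_const by blast
qed

lemma lie_bracket_linear [simp]:
  "lie_bracket G M (\<xi> + \<eta>) \<zeta> = lie_bracket G M \<xi> \<zeta> + lie_bracket G M \<eta> \<zeta>"
  "lie_bracket G M \<xi> (\<eta> + \<zeta>) = lie_bracket G M \<xi> \<eta> + lie_bracket G M \<xi> \<zeta>"
  "lie_bracket G M (r *\<^sub>R \<xi>) \<zeta> = r *\<^sub>R lie_bracket G M \<xi> \<zeta>"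
  "lie_bracket G M \<xi> (r *\<^sub>R \<zeta>) = r *\<^sub>R lie_bracket G M \<xi> \<zeta>"
  by (rule linear_add[OF bounded_linear.linear[OF lie_bracket_bounded_linear_left]]
      linear_add[OF bounded_linear.linear[OF lie_bracket_bounded_linear_right]]
      linear_scale[OF bounded_linear.linear[OF lie_bracket_bounded_linear_left]]
      linear_scale[OF bounded_linear.linear[OF lie_bracket_bounded_linear_right]])+

lemma lie_bracket_antisym: "lie_bracket G M \<xi> \<eta> = - lie_bracket G M \<eta> \<xi>"
proof -
  have "lie_bracket G M (\<xi> + \<eta>) (\<xi> + \<eta>) = lie_bracket G M \<xi> \<eta> + lie_bracket G M \<eta> \<xi>"
    unfolding lie_bracket_linear by (simp add: lie_bracket_self)
  then show ?thesis using lie_bracket_self[of "\<xi> + \<eta>"] by (metis eq_neg_iff_add_eq_0)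
qed

lemma coad_apply [simp]: "blinfun_apply (coad G M \<xi> \<mu>) \<eta> = blinfun_apply \<mu> (lie_bracket G M \<xi> \<eta>)"
proof -
  have "bounded_linear (\<lambda>\<eta>. blinfun_apply \<mu> (lie_bracket G M \<xi> \<eta>))"
    by (rule bounded_linear_compose[OF blinfun.bounded_linear_right lie_bracket_bounded_linear_right])
  then show ?thesis by (simp add: coad_def bounded_linear_Blinfun_apply)
qed

section \<open>Hamiltonian vector fields of invariant functions\<close>

text \<open>The frame is triangular: invert right translation to find \<eta>, then subtract the
  bracket to find \<zeta>, then subtract the coadjoint terms to find \<alpha> and \<beta>.\<close>

lemma frame_bij: "bij (\<lambda>a. frame G M a p)"
proof (rule bijI)
  obtain g \<xi> \<mu> \<nu> where p: "p = (g, \<xi>, \<mu>, \<nu>)" by (metis prod_cases4)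
  have R: "bij (right_translation_tangent G M g)" by (rule right_translation_tangent_bij)
  show "inj (\<lambda>a. frame G M a p)"
  proof (rule injI)
    fix a b assume eq: "frame G M a p = frame G M b p"
    obtain \<eta> \<zeta> \<alpha> \<beta> where a: "a = (\<eta>, \<zeta>, \<alpha>, \<beta>)" by (metis prod_cases4)
    obtain \<eta>' \<zeta>' \<alpha>' \<beta>' where b: "b = (\<eta>', \<zeta>', \<alpha>', \<beta>')" by (metis prod_cases4)
    have "\<eta> = \<eta>'" using eq bij_is_inj[OF R] by (simp add: a b p inj_eq)
    with eq show "a = b" by (auto simp: a b p)
  qed
  show "surj (\<lambda>a. frame G M a p)"
  proof (rule surjI)
    fix V :: "'v phase_vector"
    define f where "f = (\<lambda>(v, z, m, n). let \<eta> = inv_into UNIV (right_translation_tangent G M g) v;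
        \<zeta> = z - lie_bracket G M \<xi> \<eta>
      in (\<eta>, \<zeta>, m - coad G M \<eta> \<mu> - coad G M \<zeta> \<nu>, n - coad G M \<eta> \<nu>))"
    show "frame G M (f V) p = V"
      by (cases V) (simp add: f_def p Let_def surj_f_inv_f[OF bij_is_surj[OF R]])
  qed
qed

text \<open>Since the frame spans each tangent space bijectively, its values on frame vectors fix a
  unique function of two arguments, so the description in \<open>symplectic_form\<close> is
  met.\<close>

lemma symplectic_form_frame:
  "symplectic_form G M p (frame G M a p) (frame G M b p) = omega_on_frame G M p a b"
proof -
  let ?F = "\<lambda>a. frame G M a p"
  define \<Omega> where "\<Omega> V W = omega_on_frame G M p (inv_into UNIV ?F V) (inv_into UNIV ?F W)" for V W
  have F: "inv_into UNIV ?F (?F a) = a" for a by (rule inv_f_f[OF bij_is_inj[OF frame_bij]])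
  have surj: "\<exists>a. V = ?F a" for V using frame_bij[of p] bij_is_surj surjD by metis
  have "symplectic_form G M p = \<Omega>"
    unfolding symplectic_form_def
  proof (rule the_equality)
    show "\<forall>a b. \<Omega> (?F a) (?F b) = omega_on_frame G M p a b" by (simp add: \<Omega>_def F)
    fix \<Omega>' assume *: "\<forall>a b. \<Omega>' (?F a) (?F b) = omega_on_frame G M p a b"
    show "\<Omega>' = \<Omega>"
    proof (intro ext)
      fix V W
      obtain a b where "V = ?F a" "W = ?F b" using surj by blast
      then show "\<Omega>' V W = \<Omega> V W" using *[rule_format, of a b] by (simp add: \<Omega>_def F)
    qed
  qed
  then show ?thesis by (simp add: \<Omega>_def F)
qed

lemma lie_bracket_zero [simp]: "lie_bracket G M 0 \<xi> = 0" "lie_bracket G M \<xi> 0 = 0"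
  using lie_bracket_linear(3)[of 0 0 \<xi>] lie_bracket_linear(4)[of \<xi> 0 0] by simp_all

text \<open>Nondegeneracy in the form that gives uniqueness of a Hamiltonian vector. Test vectors
  with a single dual component isolate \<eta> and \<zeta>.\<close>

lemma omega_on_frame_nondegenerate:
  assumes eq: "\<And>b. omega_on_frame G M p a b = omega_on_frame G M p a' b"
  shows "a = a'"
proof -
  obtain B :: "'v set" and \<beta>' where co: "coordinates B \<beta>'" using coordinates_exist by blast
  obtain g \<xi> \<mu> \<nu> where p: "p = (g, \<xi>, \<mu>, \<nu>)" by (metis prod_cases4)
  obtain \<eta> \<zeta> \<alpha> \<beta> where a: "a = (\<eta>, \<zeta>, \<alpha>, \<beta>)" by (metis prod_cases4)
  obtain \<eta>' \<zeta>' \<alpha>' \<beta>' where a': "a' = (\<eta>', \<zeta>', \<alpha>', \<beta>')" by (metis prod_cases4)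
  have "blinfun_apply x \<eta> = blinfun_apply x \<eta>'" for x :: "'v \<Rightarrow>\<^sub>L real"
    using eq[of "(0, 0, x, 0)"] by (simp add: p a a')
  then have 1: "\<eta> = \<eta>'" by (rule dual_separates_points[OF co])
  have "blinfun_apply x \<zeta> = blinfun_apply x \<zeta>'" for x :: "'v \<Rightarrow>\<^sub>L real"
    using eq[of "(0, 0, 0, x)"] by (simp add: p a a')
  then have 2: "\<zeta> = \<zeta>'" by (rule dual_separates_points[OF co])
  \<comment> \<open>The remaining test vectors also produce bracket terms in \<eta> and \<zeta>,
    which agree by the two equalities already obtained.\<close>
  have 3: "\<beta> = \<beta>'"
    by (rule blinfun_eqI) (use eq[of "(0, i, 0, 0)" for i] 1 2 in \<open>simp add: p a a'\<close>)
  have 4: "\<alpha> = \<alpha>'"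
    by (rule blinfun_eqI) (use eq[of "(i, 0, 0, 0)" for i] 1 2 in \<open>simp add: p a a'\<close>)
  from 1 2 3 4 show ?thesis by (simp add: a a')
qed

text \<open>The preferred charts of the phase space are products with the identity chart, so in
  coordinates the projection \<open>snd\<close> is again \<open>snd\<close> and is its own
  derivative.\<close>

lemma differential_snd:
  assumes h: "(h has_derivative D) (at x)"
  shows "differential M (h \<circ> snd) (g, x) = (\<lambda>W. D (snd W))"
proof -
  let ?c = "prod_chart (chart_at M g) (UNIV, id) :: ('g \<times> 'v reduced_space, 'v phase_vector) chart"
  have c: "is_chart ?c" by (simp add: is_chart_prod_chart is_chart_identity)
  have p: "(g, x) \<in> cdom ?c" by (simp add: prod_chart_def chart_at_covers)
  have "(snd has_derivative snd) (at (cmap ?c (g, x)))" by (rule has_derivative_snd[OF has_derivative_ident])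
  then have "((\<lambda>z. snd (cinv ?c z)) has_derivative snd) (at (cmap ?c (g, x)))"
  proof (rule has_derivative_transform_within_open[OF _ is_chartD(2)[OF c]])
    show "cmap ?c (g, x) \<in> cmap ?c ` cdom ?c" using p by blast
    fix z assume "z \<in> cmap ?c ` cdom ?c"
    then obtain q where "q \<in> cdom ?c" "z = cmap ?c q" by blast
    then show "snd z = snd (cinv ?c z)" using is_chartD(3)[OF c] by (simp add: prod_chart_def)
  qed
  then have "chart_derivative ?c (UNIV, id) snd (g, x) snd"
    using p by (simp add: chart_derivative_def)
  then have "chart_derivative ?c (UNIV, id) (\<lambda>z. h (snd z)) (g, x) (\<lambda>W. D (snd W))"
    by (rule chart_derivative_compose[OF c is_chart_identity])
       (use h in \<open>simp add: chart_derivative_identity_charts\<close>)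
  from chart_derivative_frechet[OF this] show ?thesis
    by (simp add: differential_def tangent_map_def phase_manifold_def prod_manifold_def vector_manifold_def comp_def)
qed

text \<open>Compare coefficients of the components of b in \<open>om\<close>: the dual components
  give the first two entries, the vector components the last two. The coadjoint corrections in
  \<open>frame\<close> match the \<mu> and \<nu> terms of \<open>omega_on_frame\<close> up to
  antisymmetry, so only the derivative in \<xi> survives in those last entries.\<close>

lemma hamiltonian_field_invariant:
  assumes h: "h differentiable (at (\<xi>, \<mu>, \<nu>))"
  shows "hamiltonian_field G M (h \<circ> snd) (g, \<xi>, \<mu>, \<nu>) =
    frame G M (delta_mu h (\<xi>, \<mu>, \<nu>), delta_nu h (\<xi>, \<mu>, \<nu>),
      - coad G M \<xi> (delta_xi h (\<xi>, \<mu>, \<nu>)), - delta_xi h (\<xi>, \<mu>, \<nu>)) (g, \<xi>, \<mu>, \<nu>)"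
    (is "_ = frame G M ?a ?p")
proof -
  obtain B :: "'v set" and \<beta>' where co: "coordinates B \<beta>'" using coordinates_exist by blast
  obtain D where D: "(h has_derivative D) (at (\<xi>, \<mu>, \<nu>))" using h by (auto simp: differentiable_def)
  have split: "D (v, \<alpha>, \<beta>) = blinfun_apply (delta_xi h (\<xi>, \<mu>, \<nu>)) v
      + blinfun_apply \<alpha> (delta_mu h (\<xi>, \<mu>, \<nu>)) + blinfun_apply \<beta> (delta_nu h (\<xi>, \<mu>, \<nu>))" for v \<alpha> \<beta>
    using linear_add[OF has_derivative_linear[OF D], of "(v, 0, 0)" "(0, \<alpha>, \<beta>)"]
      linear_add[OF has_derivative_linear[OF D], of "(0, \<alpha>, 0)" "(0, 0, \<beta>)"]
    by (simp add: delta_xi_eq[OF D] delta_mu_nu_eq(3,4)[OF co D])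
  have om: "omega_on_frame G M ?p ?a b = - differential M (h \<circ> snd) ?p (frame G M b ?p)" for b
  proof -
    obtain \<eta> \<zeta> \<alpha> \<beta> where b: "b = (\<eta>, \<zeta>, \<alpha>, \<beta>)" by (metis prod_cases4)
    show ?thesis
      unfolding differential_snd[OF D]
      by (simp add: b split blinfun.bilinear_simps lie_bracket_antisym[of \<eta>] lie_bracket_antisym[of \<zeta>])
  qed
  show ?thesis
    unfolding hamiltonian_field_def
  proof (rule the_equality)
    show "\<forall>W. symplectic_form G M ?p (frame G M ?a ?p) W = - differential M (h \<circ> snd) ?p W"
    proof
      fix W
      obtain b where "W = frame G M b ?p" using frame_bij[of ?p] bij_is_surj surjD by metis
      then show "symplectic_form G M ?p (frame G M ?a ?p) W = - differential M (h \<circ> snd) ?p W"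
        using symplectic_form_frame om by (simp del: frame.simps omega_on_frame.simps)
    qed
    fix V assume V: "\<forall>W. symplectic_form G M ?p V W = - differential M (h \<circ> snd) ?p W"
    obtain a where a: "V = frame G M a ?p" using frame_bij[of ?p] bij_is_surj surjD by metis
    have "omega_on_frame G M ?p a b = omega_on_frame G M ?p ?a b" for b
      using V[rule_format, of "frame G M b ?p"] unfolding a symplectic_form_frame om .
    then show "V = frame G M ?a ?p" using omega_on_frame_nondegenerate a by blast
  qed
qed

section \<open>The reduced bracket, its smoothness and the functions on the quotient\<close>

definition reduced_bracket ::
  "('v reduced_space \<Rightarrow> real) \<Rightarrow> ('v reduced_space \<Rightarrow> real) \<Rightarrow> 'v reduced_space \<Rightarrow> real" where
  "reduced_bracket H K = (\<lambda>x. case x of (\<xi>, \<mu>, \<nu>) \<Rightarrow>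
              blinfun_apply (delta_xi K x) (delta_nu H x)
            - blinfun_apply (delta_xi H x) (delta_nu K x)
            + blinfun_apply \<mu> (lie_bracket G M (delta_mu H x) (delta_mu K x))
            + blinfun_apply (coad G M \<xi> (delta_xi K x)) (delta_mu H x)
            - blinfun_apply (coad G M \<xi> (delta_xi H x)) (delta_mu K x)
            + blinfun_apply \<nu> (lie_bracket G M (delta_mu H x) (delta_nu K x)
                              - lie_bracket G M (delta_mu K x) (delta_nu H x)))"

lemma poisson_bracket_invariant:
  assumes "H differentiable (at x)" "K differentiable (at x)"
  shows "poisson_bracket G M (H \<circ> snd) (K \<circ> snd) (g, x) = reduced_bracket H K x"
proof -
  obtain \<xi> \<mu> \<nu> where x: "x = (\<xi>, \<mu>, \<nu>)" by (metis prod_cases3)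
  show ?thesis
    using assms
    \<comment> \<open>The frame vectors stay folded here so that
      \<open>symplectic_form_frame\<close> can rewrite them.\<close>
    by (simp add: x poisson_bracket_def hamiltonian_field_invariant symplectic_form_frame del: frame.simps)
       (simp add: reduced_bracket_def blinfun.bilinear_simps)
qed

text \<open>The bracket is known to be bounded linear in each argument separately. Expanding the
  first argument in coordinates reduces it to finitely many bounded linear maps with smooth
  coefficients.\<close>

lemma smooth_on_lie_bracket:
  assumes "open S" "smooth_on S f" "smooth_on S g"
  shows "smooth_on S (\<lambda>x. lie_bracket G M (f x) (g x))"
proof -
  obtain B :: "'v set" and \<beta> where co: "coordinates B \<beta>" using coordinates_exist by blast
  have "smooth_on S (\<lambda>x. \<Sum>b\<in>B. \<beta> b (f x) *\<^sub>R lie_bracket G M b (g x))"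
    by (intro smooth_on_sum smooth_on_bilinear[OF _ bounded_bilinear_scaleR]
        smooth_on_bounded_linear_compose[OF _ coordinatesD(2)[OF co]]
        smooth_on_bounded_linear_compose[OF _ lie_bracket_bounded_linear_right] assms)
  moreover have "lie_bracket G M (f x) (g x) = (\<Sum>b\<in>B. \<beta> b (f x) *\<^sub>R lie_bracket G M b (g x))" for x
    by (rule linear_coordinates_expand[OF co bounded_linear.linear[OF lie_bracket_bounded_linear_left]])
  ultimately show ?thesis by simp
qed

lemma smooth_on_reduced_bracket:
  assumes H: "smooth_on UNIV H" and K: "smooth_on UNIV K"
  shows "smooth_on UNIV (reduced_bracket H K)"
proof -
  obtain B :: "'v set" and \<beta> where co: "coordinates B \<beta>" using coordinates_exist by blast
  note sH = smooth_on_delta[OF co H] and sK = smooth_on_delta[OF co K]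
  have sx: "smooth_on UNIV (fst :: 'v reduced_space \<Rightarrow> _)"
    by (intro smooth_on_bounded_linear open_UNIV bounded_linear_fst)
  have sm: "smooth_on UNIV (\<lambda>x :: 'v reduced_space. fst (snd x))"
    by (intro smooth_on_bounded_linear open_UNIV bounded_linear_fst_comp bounded_linear_snd)
  have sn: "smooth_on UNIV (\<lambda>x :: 'v reduced_space. snd (snd x))"
    by (intro smooth_on_bounded_linear open_UNIV bounded_linear_snd_comp bounded_linear_snd)
  note app = smooth_on_bilinear[OF open_UNIV bounded_bilinear_blinfun_apply]
  note br = smooth_on_lie_bracket[OF open_UNIV]
  \<comment> \<open>The coadjoint terms are rewritten as \<open>delta_xi\<close> evaluated on a
    bracket, which avoids treating \<open>coad\<close> as a smooth map into the dual.\<close>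
  have "smooth_on UNIV (\<lambda>x.
              blinfun_apply (delta_xi K x) (delta_nu H x)
            - blinfun_apply (delta_xi H x) (delta_nu K x)
            + blinfun_apply (fst (snd x)) (lie_bracket G M (delta_mu H x) (delta_mu K x))
            + blinfun_apply (delta_xi K x) (lie_bracket G M (fst x) (delta_mu H x))
            - blinfun_apply (delta_xi H x) (lie_bracket G M (fst x) (delta_mu K x))
            + blinfun_apply (snd (snd x)) (lie_bracket G M (delta_mu H x) (delta_nu K x)
                              - lie_bracket G M (delta_mu K x) (delta_nu H x)))"
    by (intro smooth_on_add[OF open_UNIV] smooth_on_diff[OF open_UNIV] app br sH sK sx sm sn)
  then show ?thesis by (simp add: reduced_bracket_def case_prod_beta')
qed

text \<open>In a product chart with nonempty domain the coordinate form of
  \<open>h \<circ> snd\<close> is again h composed with \<open>snd\<close>, so every such chart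
  tests the same condition on h.\<close>

lemma smooth_map_snd_iff:
  "smooth_map (phase_manifold M) vector_manifold (h \<circ> snd) \<longleftrightarrow> smooth_on UNIV (h :: 'v reduced_space \<Rightarrow> real)"
proof -
  let ?c = "\<lambda>c. prod_chart c (UNIV, id) :: ('g \<times> 'v reduced_space, 'v phase_vector) chart"
  have loc: "smooth_on (cmap (?c c) ` cdom (?c c)) (\<lambda>z. h (snd (cinv (?c c) z))) \<longleftrightarrow> smooth_on UNIV h"
    if c: "c \<in> atlas M" "cdom c \<noteq> {}" for c
  proof -
    have ch: "is_chart c" "is_chart (?c c)"
      using c by (simp_all add: atlas_is_chart is_chart_prod_chart is_chart_identity)
    have im: "cmap (?c c) ` cdom (?c c) = cmap c ` cdom c \<times> UNIV"
      by (auto simp: prod_chart_def image_iff)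
    have op: "open (cmap c ` cdom c \<times> (UNIV :: 'v reduced_space set))"
      using is_chartD(2)[OF ch(2)] im by simp
    have eq: "snd (cinv (?c c) z) = snd z" if "z \<in> cmap c ` cdom c \<times> UNIV" for z
      using that by (auto simp: cinv_prod_chart[OF ch(1) is_chart_identity])
    obtain u where u: "u \<in> cmap c ` cdom c" using c(2) by blast
    have "Ck_on k (cmap c ` cdom c \<times> UNIV) (\<lambda>z. h (snd (cinv (?c c) z))) \<longleftrightarrow>
        Ck_on k (cmap c ` cdom c \<times> UNIV) (\<lambda>z. h (snd z))" for k
      by (rule iffI; erule Ck_on_cong[OF op, rotated]) (simp_all add: eq)
    then show ?thesis
      unfolding im smooth_on_def using Ck_on_snd_iff[OF is_chartD(2)[OF ch(1)] u] by blast
  qed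
  \<comment> \<open>The atlas may contain charts with empty domain, where the condition is vacuous.
    Smoothness of h is therefore read off from the chart at the identity.\<close>
  have loc0: "smooth_on (cmap (?c c) ` cdom (?c c)) (\<lambda>z. h (snd (cinv (?c c) z)))"
    if "cdom c = {}" for c
  proof -
    have "Ck_on k ({} :: 'v phase_vector set) f" for k and f :: "_ \<Rightarrow> real"
      by (induction k arbitrary: f) auto
    with that show ?thesis by (simp add: smooth_on_def prod_chart_def)
  qed
  have at: "atlas (phase_manifold M) = ?c ` atlas M"
    by (auto simp: phase_manifold_def prod_manifold_def vector_manifold_def simp del: split_paired_Ex)
  have cont: "continuous_on UNIV (h \<circ> snd :: 'g \<times> 'v reduced_space \<Rightarrow> real)" if "smooth_on UNIV h"
    unfolding comp_def
    by (rule continuous_on_compose2[OF smooth_on_imp_continuous_on[OF that] continuous_on_snd[OF continuous_on_id]]) simp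
  have one: "chart_at M \<one> \<in> atlas M" "cdom (chart_at M \<one>) \<noteq> {}"
    using chart_at_in_atlas chart_at_covers by auto
  have "smooth_map (phase_manifold M) vector_manifold (h \<circ> snd) \<longleftrightarrow>
      continuous_on UNIV (h \<circ> snd :: 'g \<times> 'v reduced_space \<Rightarrow> real) \<and>
      (\<forall>c\<in>atlas M. smooth_on (cmap (?c c) ` cdom (?c c)) (\<lambda>z. h (snd (cinv (?c c) z))))"
    unfolding smooth_map_def at by (simp add: vector_manifold_def comp_def)
  also have "\<dots> \<longleftrightarrow> smooth_on UNIV h"
  proof
    assume "continuous_on UNIV (h \<circ> snd :: 'g \<times> 'v reduced_space \<Rightarrow> real) \<and>
      (\<forall>c\<in>atlas M. smooth_on (cmap (?c c) ` cdom (?c c)) (\<lambda>z. h (snd (cinv (?c c) z))))"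
    then show "smooth_on UNIV h" using loc[OF one] one(1) by blast
  next
    assume h: "smooth_on UNIV h"
    have "smooth_on (cmap (?c c) ` cdom (?c c)) (\<lambda>z. h (snd (cinv (?c c) z)))" if "c \<in> atlas M" for c
      using loc[OF that] loc0[of c] h by (cases "cdom c = {}") simp_all
    with cont[OF h] show "continuous_on UNIV (h \<circ> snd :: 'g \<times> 'v reduced_space \<Rightarrow> real) \<and>
      (\<forall>c\<in>atlas M. smooth_on (cmap (?c c) ` cdom (?c c)) (\<lambda>z. h (snd (cinv (?c c) z))))" by blast
  qed
  finally show ?thesis .
qed

lemma invariant_functions_eq:
  "invariant_functions M = (\<lambda>h. h \<circ> snd) ` {h :: 'v reduced_space \<Rightarrow> real. smooth_on UNIV h}"
proof (intro equalityI subsetI)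
  fix H assume H: "H \<in> invariant_functions M"
  define h where "h x = H (\<one>, x)" for x
  have "H = h \<circ> snd" using H by (auto simp: invariant_functions_def h_def fun_eq_iff)
  moreover from this have "smooth_on UNIV h"
    using H smooth_map_snd_iff[of h] by (simp add: invariant_functions_def)
  ultimately show "H \<in> (\<lambda>h. h \<circ> snd) ` {h. smooth_on UNIV h}" by blast
qed (auto simp: invariant_functions_def smooth_map_snd_iff)

lemma poisson_bracket_smooth:
  assumes "smooth_on UNIV H" "smooth_on UNIV K"
  shows "poisson_bracket G M (H \<circ> snd) (K \<circ> snd) = reduced_bracket H K \<circ> snd"
proof
  fix p :: "'g \<times> 'v reduced_space"
  have "H differentiable (at (snd p))" "K differentiable (at (snd p))"
    using smooth_on_has_derivative[OF assms(1), of "snd p"] smooth_on_has_derivative[OF assms(2), of "snd p"]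
    by (auto intro: differentiableI)
  from poisson_bracket_invariant[OF this, of "fst p"]
  show "poisson_bracket G M (H \<circ> snd) (K \<circ> snd) p = (reduced_bracket H K \<circ> snd) p" by simp
qed

end

theorem mainTheorem5:
  fixes G :: "'g::t2_space monoid" and M :: "('g, 'v::banach) manifold"
  assumes "lie_group G M"
  shows "bij_betw (\<lambda>h. h \<circ> snd)
           {h :: 'v reduced_space \<Rightarrow> real. smooth_map vector_manifold vector_manifold h}
           (invariant_functions M)
    \<and> (\<forall>H \<in> invariant_functions M. \<forall>K \<in> invariant_functions M.
           poisson_bracket G M H K \<in> invariant_functions M)
    \<and> (\<forall>H K :: 'v reduced_space \<Rightarrow> real.
         smooth_map vector_manifold vector_manifold H \<longrightarrow>
         smooth_map vector_manifold vector_manifold K \<longrightarrow>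
         (\<forall>g \<xi> \<mu> \<nu>. let x = (\<xi>, \<mu>, \<nu>) in
            poisson_bracket G M (H \<circ> snd) (K \<circ> snd) (g, x) =
              blinfun_apply (delta_xi K x) (delta_nu H x)
            - blinfun_apply (delta_xi H x) (delta_nu K x)
            + blinfun_apply \<mu> (lie_bracket G M (delta_mu H x) (delta_mu K x))
            + blinfun_apply (coad G M \<xi> (delta_xi K x)) (delta_mu H x)
            - blinfun_apply (coad G M \<xi> (delta_xi H x)) (delta_mu K x)
            + blinfun_apply \<nu> (lie_bracket G M (delta_mu H x) (delta_nu K x)
                              - lie_bracket G M (delta_mu K x) (delta_nu H x))))"
proof -
  interpret lie_group G M by fact
  have "inj (\<lambda>h :: 'v reduced_space \<Rightarrow> real. h \<circ> (snd :: ('g, 'v) phase_space \<Rightarrow> _))"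
    by (auto simp: inj_def fun_eq_iff)
  then have "bij_betw (\<lambda>h. h \<circ> snd)
      {h :: 'v reduced_space \<Rightarrow> real. smooth_map vector_manifold vector_manifold h} (invariant_functions M)"
    unfolding smooth_map_vector_manifold_iff invariant_functions_eq
    by (intro inj_on_imp_bij_betw) (rule inj_on_subset, auto)
  moreover have "poisson_bracket G M H K \<in> invariant_functions M"
    if "H \<in> invariant_functions M" "K \<in> invariant_functions M" for H K
    using that poisson_bracket_smooth smooth_on_reduced_bracket unfolding invariant_functions_eq by auto
  ultimately show ?thesis
    by (simp add: smooth_map_vector_manifold_iff poisson_bracket_smooth reduced_bracket_def)
qed

end
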